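(* Let $f:\mathbb{R}^n\to\mathbb{R}$ be continuously differentiable with locally Lipschitz continuous gradient, let $P_1:\mathbb{R}^n\to(-\infty,\infty]$ be proper, closed (lower semicontinuous) and prox-bounded (there is $\gamma>0$ with $\inf\{P_1+\frac{\gamma}{2}\|\cdot\|^2\}>-\infty$), let $P_2:\mathbb{R}^n\to\mathbb{R}$ be convex, and suppose $F:=f+P_1-P_2$ is bounded from below on $\mathrm{dom}\,P_1$. Let $\mathcal{S}$ be the set of stationary points of $\min_{\bm{x}\in\mathbb{R}^n}F(\bm{x})$, and suppose that $P_2$ is continuously differentiable on an open set $\mathcal{N}_{\mathcal{S}}$ containing $\mathcal{S}$ and that $\nabla P_2$ is locally Lipschitz continuous on $\mathcal{N}_{\mathcal{S}}$. Let the parameters satisfy $0<\gamma_{\min}\leq\gamma_{\max}<\infty$, $\beta_{\max}\geq0$, $0<p_{\min}<1$, $0\leq\delta<1$, $\tau>1$, $0<\eta<\frac{1}{\sqrt{\tau}}$, and let $\{\bm{x}^k\}$ be a sequence generated by the algorithm nexPGA. Suppose that $\{\bm{x}^k\}$ has an accumulation point $\bm{x}^*$ and that the potential function $H_\delta(\bm{u},\bm{v},\gamma)=F(\bm{u})+\frac{\delta\gamma}{8}\|\bm{u}-\bm{v}\|^2$ is a KL function. Then the whole sequence $\{\bm{x}^k\}$ converges to $\bm{x}^*$, and $\bm{x}^*$ is a stationary point of $\min_{\bm{x}\in\mathbb{R}^n}F(\bm{x})$.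
   Context: $\|\cdot\|$ is the Euclidean norm. For a proper function $h$, $\partial h$ is the limiting subdifferential: for $\bm{x}\in\mathrm{dom}\,h$, $\bm{d}\in\partial h(\bm{x})$ iff there are $\bm{x}^k\to\bm{x}$ with $h(\bm{x}^k)\to h(\bm{x})$ and $\bm{d}^k\to\bm{d}$ with $\bm{d}^k\in\widehat\partial h(\bm{x}^k)$ for all $k$, where $\widehat\partial h(\bm{y})$ is the Fréchet subdifferential, i.e. the set of $\bm{d}$ with $\liminf_{\bm{z}\to\bm{y},\bm{z}\neq\bm{y}}\frac{h(\bm{z})-h(\bm{y})-\langle\bm{d},\bm{z}-\bm{y}\rangle}{\|\bm{z}-\bm{y}\|}\ge0$. For convex $h$ it is the usual convex subdifferential. Stationary point: $\bm{x}^*\in\mathrm{dom}\,F$ with $0\in\nabla f(\bm{x}^* )+\partial P_1(\bm{x}^* )-\partial P_2(\bm{x}^* )$. Potential function: $H_\delta(\bm{u},\bm{v},\gamma):=F(\bm{u})+\frac{\delta\gamma}{8}\|\bm{u}-\bm{v}\|^2$ for $\bm{u},\bm{v}\in\mathbb{R}^n$, $\gamma>0$ (a function on $\mathbb{R}^n\times\mathbb{R}^n\times(0,\infty)$; its subdifferential and the KL property are taken at points with $\gamma>0$, with respect to all three variables). KL property: for $\nu>0$ let $\Phi_\nu$ be the class of concave $\varphi:[0,\nu)\to\mathbb{R}_+$ with $\varphi(0)=0$, $\varphi$ continuous at $0$ and continuously differentiable on $(0,\nu)$, and $\varphi'>0$ on $(0,\nu)$. A proper closed function $h$ has the KL property at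 $\tilde{\bm{x}}\in\mathrm{dom}\,\partial h$ if there are $\nu\in(0,+\infty]$, a neighborhood $\mathcal{V}$ of $\tilde{\bm{x}}$ and $\varphi\in\Phi_\nu$ such that $\varphi'(h(\bm{x})-h(\tilde{\bm{x}}))\,\mathrm{dist}(\bm{0},\partial h(\bm{x}))\ge1$ for all $\bm{x}\in\mathcal{V}$ with $h(\tilde{\bm{x}})<h(\bm{x})<h(\tilde{\bm{x}})+\nu$. $h$ is a KL function if it has the KL property at each point of $\mathrm{dom}\,\partial h$. Algorithm nexPGA. Start from $\bm{x}^0\in\mathrm{dom}\,P_1$; set $\bm{x}^{-1}=\bm{x}^0$, $\overline\gamma_{-1}=\gamma_{\min}$, $\mathcal{R}_0=F(\bm{x}^0)$. For $k=0,1,2,\dots$ (run indefinitely): Step 1: take any $\bm{\xi}^k\in\partial P_2(\bm{x}^k)$ and arbitrary $\beta_{k,0}\in[0,\delta\beta_{\max}]$, $\gamma_{k,0}\in[\gamma_{\min},\gamma_{\max}]$. For $i=0,1,2,\dots$, with $\beta_{k,i}=\eta^i\beta_{k,0}$ and $\gamma_{k,i}=\tau^i\gamma_{k,0}$, set $\bm{y}^{k,i}=\bm{x}^k+\beta_{k,i}(\bm{x}^k-\bm{x}^{k-1})$, and take any global minimizer $$\bm{x}^{k,i}\in\arg\min_{\bm{x}\in\mathbb{R}^n}\Big\{\langle\nabla f(\bm{y}^{k,i})-\bm{\xi}^k,\bm{x}-\bm{y}^{k,i}\rangle+\tfrac{\gamma_{k,i}}{2}\|\bm{x}-\bm{y}^{k,i}\|^2+P_1(\bm{x})\Big\}$$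 (if no minimizer exists, trial $i$ counts as failed). Stop the inner loop at the first $i$ for which the line search criterion $H_\delta(\bm{x}^{k,i},\bm{x}^k,\gamma_{k,i})-\mathcal{R}_k\le-\frac{(1-\delta)\gamma_{k,i}}{8}\|\bm{x}^{k,i}-\bm{x}^k\|^2$ holds. Step 2: with that $i$, set $\overline\beta_k=\beta_{k,i}$, $\overline\gamma_k=\gamma_{k,i}$, $\bm{x}^{k+1}=\bm{x}^{k,i}$; choose any $p_{k+1}\in[p_{\min},1]$ and set $\mathcal{R}_{k+1}=(1-p_{k+1})\mathcal{R}_k+p_{k+1}H_\delta(\bm{x}^{k+1},\bm{x}^k,\overline\gamma_k)$. *)

theory Defs
  imports "HOL-Analysis.Analysis"
begin

section \<open>Extended-real-valued functions and subdifferentials\<close>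

definition effdom :: "('a \<Rightarrow> ereal) \<Rightarrow> 'a set"
  where "effdom h = {x. h x < \<infinity>}"

definition proper_fun :: "('a \<Rightarrow> ereal) \<Rightarrow> bool"
  where "proper_fun h \<longleftrightarrow> (\<forall>x. h x \<noteq> -\<infinity>) \<and> effdom h \<noteq> {}"

definition lsc :: "('a::topological_space \<Rightarrow> ereal) \<Rightarrow> bool"
  where "lsc h \<longleftrightarrow> (\<forall>x. h x \<le> Liminf (at x) h)"

definition prox_bounded :: "('a::real_inner \<Rightarrow> ereal) \<Rightarrow> bool"
  where "prox_bounded h \<longleftrightarrow>
    (\<exists>\<gamma>>0. (INF x. h x + ereal (\<gamma> / 2 * (norm x)\<^sup>2)) > -\<infinity>)"

definition frechet_subdiff :: "('a::real_inner \<Rightarrow> ereal) \<Rightarrow> 'a \<Rightarrow> 'a set"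
  where "frechet_subdiff h y =
    {d. \<bar>h y\<bar> \<noteq> \<infinity> \<and>
        0 \<le> Liminf (at y) (\<lambda>z. (h z - h y - ereal (d \<bullet> (z - y))) / ereal (norm (z - y)))}"

definition limiting_subdiff :: "('a::real_inner \<Rightarrow> ereal) \<Rightarrow> 'a \<Rightarrow> 'a set"
  where "limiting_subdiff h x =
    {d. \<bar>h x\<bar> \<noteq> \<infinity> \<and>
        (\<exists>X D. X \<longlonglongrightarrow> x \<and> (\<lambda>k. h (X k)) \<longlonglongrightarrow> h x \<and> D \<longlonglongrightarrow> d \<and>
               (\<forall>k. D k \<in> frechet_subdiff h (X k)))}"

definition dom_subdiff :: "('a::real_inner \<Rightarrow> ereal) \<Rightarrow> 'a set"
  where "dom_subdiff h = {x. limiting_subdiff h x \<noteq> {}}"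

text \<open>Taken as an infimum in \<^typ>\<open>ereal\<close>, the distance to the empty set is infinite; the library's
  \<^const>\<open>infdist\<close> would give 0.\<close>

definition edist_to :: "'a::metric_space \<Rightarrow> 'a set \<Rightarrow> ereal"
  where "edist_to x A = (INF a\<in>A. ereal (dist x a))"


section \<open>The Kurdyka-Lojasiewicz property\<close>

definition desingularizing :: "ereal \<Rightarrow> (real \<Rightarrow> real) set"
  where "desingularizing \<nu> =
    {\<phi>. concave_on {s. 0 \<le> s \<and> ereal s < \<nu>} \<phi> \<and>
        (\<forall>s. 0 \<le> s \<and> ereal s < \<nu> \<longrightarrow> 0 \<le> \<phi> s) \<and>
        \<phi> 0 = 0 \<and>
        continuous (at 0 within {s. 0 \<le> s \<and> ereal s < \<nu>}) \<phi> \<and>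
        (\<forall>s. 0 < s \<and> ereal s < \<nu> \<longrightarrow> \<phi> differentiable at s) \<and>
        continuous_on {s. 0 < s \<and> ereal s < \<nu>} (deriv \<phi>) \<and>
        (\<forall>s. 0 < s \<and> ereal s < \<nu> \<longrightarrow> 0 < deriv \<phi> s)}"

definition KL_at :: "('a::real_inner \<Rightarrow> ereal) \<Rightarrow> 'a \<Rightarrow> bool"
  where "KL_at h x' \<longleftrightarrow>
    x' \<in> dom_subdiff h \<and>
    (\<exists>\<nu> V \<phi>. 0 < \<nu> \<and> open V \<and> x' \<in> V \<and> \<phi> \<in> desingularizing \<nu> \<and>
      (\<forall>x\<in>V. h x' < h x \<and> h x < h x' + \<nu> \<longrightarrow>
        ereal (deriv \<phi> (real_of_ereal (h x - h x'))) * edist_to 0 (limiting_subdiff h x) \<ge> 1))"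

text \<open>KL function on an open set \<open>U\<close>: the subdifferential and the KL property at a point depend only
  on the values near that point, so a function on \<open>U\<close> may be represented by any extension of it.\<close>

definition KL_function_on :: "'a::real_inner set \<Rightarrow> ('a \<Rightarrow> ereal) \<Rightarrow> bool"
  where "KL_function_on U h \<longleftrightarrow> (\<forall>x \<in> dom_subdiff h \<inter> U. KL_at h x)"


section \<open>Smoothness\<close>

definition locally_lipschitz_on :: "'a::metric_space set \<Rightarrow> ('a \<Rightarrow> 'b::metric_space) \<Rightarrow> bool"
  where "locally_lipschitz_on U g \<longleftrightarrow> (\<forall>x\<in>U. \<exists>r>0. \<exists>L. L-lipschitz_on (ball x r \<inter> U) g)"

text \<open>\<open>h\<close> is continuously differentiable on the open set \<open>U\<close>, with gradient \<open>g\<close>.\<close>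

definition C1_with_gradient_on :: "'a::real_inner set \<Rightarrow> ('a \<Rightarrow> real) \<Rightarrow> ('a \<Rightarrow> 'a) \<Rightarrow> bool"
  where "C1_with_gradient_on U h g \<longleftrightarrow> (\<forall>x\<in>U. GDERIV h x :> g x) \<and> continuous_on U g"


section \<open>The problem\<close>

definition objective ::
  "('a \<Rightarrow> real) \<Rightarrow> ('a \<Rightarrow> ereal) \<Rightarrow> ('a \<Rightarrow> real) \<Rightarrow> 'a \<Rightarrow> ereal"
  where "objective f P1 P2 x = ereal (f x) + P1 x - ereal (P2 x)"

text \<open>Here and below \<open>g\<close> stands for the gradient of \<open>f\<close>.\<close>

definition stationary_point ::
  "('a::real_inner \<Rightarrow> real) \<Rightarrow> ('a \<Rightarrow> 'a) \<Rightarrow> ('a \<Rightarrow> ereal) \<Rightarrow> ('a \<Rightarrow> real) \<Rightarrow> 'a \<Rightarrow> bool"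
  where "stationary_point f g P1 P2 x \<longleftrightarrow>
    x \<in> effdom (objective f P1 P2) \<and>
    (\<exists>a \<in> limiting_subdiff P1 x. \<exists>b \<in> limiting_subdiff (\<lambda>z. ereal (P2 z)) x. 0 = g x + a - b)"

text \<open>The potential function is only meant for \<open>\<gamma> > 0\<close>.\<close>

definition potential ::
  "('a::real_inner \<Rightarrow> real) \<Rightarrow> ('a \<Rightarrow> ereal) \<Rightarrow> ('a \<Rightarrow> real) \<Rightarrow> real \<Rightarrow> 'a \<times> 'a \<times> real \<Rightarrow> ereal"
  where "potential f P1 P2 \<delta> =
    (\<lambda>(u, v, \<gamma>). objective f P1 P2 u + ereal (\<delta> * \<gamma> / 8 * (norm (u - v))\<^sup>2))"


section \<open>The algorithm nexPGA\<close>

definition nexPGA_model ::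
  "('a::real_inner \<Rightarrow> 'a) \<Rightarrow> ('a \<Rightarrow> ereal) \<Rightarrow> 'a \<Rightarrow> 'a \<Rightarrow> real \<Rightarrow> 'a \<Rightarrow> ereal"
  where "nexPGA_model g P1 \<xi> y \<gamma> z =
    ereal ((g y - \<xi>) \<bullet> (z - y) + \<gamma> / 2 * (norm (z - y))\<^sup>2) + P1 z"

definition line_search_ok ::
  "('a::real_inner \<Rightarrow> real) \<Rightarrow> ('a \<Rightarrow> ereal) \<Rightarrow> ('a \<Rightarrow> real) \<Rightarrow> real \<Rightarrow> ereal \<Rightarrow> 'a \<Rightarrow> real \<Rightarrow> 'a \<Rightarrow> bool"
  where "line_search_ok f P1 P2 \<delta> R xk \<gamma> z \<longleftrightarrow>
    potential f P1 P2 \<delta> (z, xk, \<gamma>) - R \<le> ereal (- ((1 - \<delta>) * \<gamma> / 8 * (norm (z - xk))\<^sup>2))"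

text \<open>In a run, \<open>trial k i\<close> is the minimizer chosen in inner step \<open>i\<close> of iteration \<open>k\<close> (meaningless if
  there is none) and \<open>acc k\<close> is the index of the accepted trial. Since subtraction on \<^typ>\<open>nat\<close>
  truncates, \<open>x (k - 1)\<close> for \<open>k = 0\<close> is \<open>x 0\<close>, which is the convention for the iterate with index
  \<open>-1\<close>. All values \<open>R k\<close> are finite.\<close>

definition nexPGA_run ::
  "('a::real_inner \<Rightarrow> real) \<Rightarrow> ('a \<Rightarrow> 'a) \<Rightarrow> ('a \<Rightarrow> ereal) \<Rightarrow> ('a \<Rightarrow> real) \<Rightarrow>
   real \<Rightarrow> real \<Rightarrow> real \<Rightarrow> real \<Rightarrow> real \<Rightarrow> real \<Rightarrow> real \<Rightarrow>
   (nat \<Rightarrow> 'a) \<Rightarrow> (nat \<Rightarrow> 'a) \<Rightarrow> (nat \<Rightarrow> real) \<Rightarrow> (nat \<Rightarrow> real) \<Rightarrow>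
   (nat \<Rightarrow> nat \<Rightarrow> 'a) \<Rightarrow> (nat \<Rightarrow> nat) \<Rightarrow> (nat \<Rightarrow> real) \<Rightarrow> (nat \<Rightarrow> ereal) \<Rightarrow> bool"
  where "nexPGA_run f g P1 P2 \<gamma>min \<gamma>max \<beta>max pmin \<delta> \<tau> \<eta> x \<xi> \<beta>0 \<gamma>0 trial acc p R \<longleftrightarrow>
    x 0 \<in> effdom P1 \<and>
    R 0 = objective f P1 P2 (x 0) \<and>
    (\<forall>k.
      let \<beta> = (\<lambda>i. \<eta> ^ i * \<beta>0 k);
          \<gamma> = (\<lambda>i. \<tau> ^ i * \<gamma>0 k);
          y = (\<lambda>i. x k + \<beta> i *\<^sub>R (x k - x (k - 1)));
          minimizer = (\<lambda>i. is_arg_min (nexPGA_model g P1 (\<xi> k) (y i) (\<gamma> i)) (\<lambda>_. True));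
          ok = (\<lambda>i. line_search_ok f P1 P2 \<delta> (R k) (x k) (\<gamma> i) (trial k i))
      in \<xi> k \<in> limiting_subdiff (\<lambda>z. ereal (P2 z)) (x k) \<and>
         \<beta>0 k \<in> {0..\<delta> * \<beta>max} \<and>
         \<gamma>0 k \<in> {\<gamma>min..\<gamma>max} \<and>
         (\<forall>i<acc k. (\<nexists>z. minimizer i z) \<or> (minimizer i (trial k i) \<and> \<not> ok i)) \<and>
         minimizer (acc k) (trial k (acc k)) \<and> ok (acc k) \<and>
         x (Suc k) = trial k (acc k) \<and>
         p (Suc k) \<in> {pmin..1} \<and>
         R (Suc k) = ereal (1 - p (Suc k)) * R k
                     + ereal (p (Suc k)) * potential f P1 P2 \<delta> (x (Suc k), x k, \<gamma> (acc k)))"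

definition nexPGA_sequence ::
  "('a::real_inner \<Rightarrow> real) \<Rightarrow> ('a \<Rightarrow> 'a) \<Rightarrow> ('a \<Rightarrow> ereal) \<Rightarrow> ('a \<Rightarrow> real) \<Rightarrow>
   real \<Rightarrow> real \<Rightarrow> real \<Rightarrow> real \<Rightarrow> real \<Rightarrow> real \<Rightarrow> real \<Rightarrow> (nat \<Rightarrow> 'a) \<Rightarrow> bool"
  where "nexPGA_sequence f g P1 P2 \<gamma>min \<gamma>max \<beta>max pmin \<delta> \<tau> \<eta> x \<longleftrightarrow>
    (\<exists>\<xi> \<beta>0 \<gamma>0 trial acc p R.
      nexPGA_run f g P1 P2 \<gamma>min \<gamma>max \<beta>max pmin \<delta> \<tau> \<eta> x \<xi> \<beta>0 \<gamma>0 trial acc p R)"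

end

theory Submission
  imports Defs
begin

text \<open>The reference values \<open>R k\<close> decrease to a limit \<open>R\<^sub>*\<close>, and their decrease dominates
  \<open>\<parallel>x\<^sup>k\<^sup>+\<^sup>1 - x\<^sup>k\<parallel>\<^sup>2\<close>. A priori the step sizes are unbounded, but while \<open>x k\<close> stays near the
  accumulation point, a local Lipschitz constant of the gradient bounds the number of backtracking
  steps. Hence the accumulation point is stationary with \<open>F\<close>-value \<open>R\<^sub>*\<close>, and the subgradients of
  the potential at the iterates are bounded by two consecutive step lengths.
  The step sizes need not converge, so the KL inequality is first made uniform over a compact
  interval of them.

  The search is non-monotone: KL controls the potential value \<open>h k\<close>, whereas only \<open>R k\<close> decreases.
  With \<open>a\<close> and \<open>s\<close> the excesses over \<open>R\<^sub>*\<close> of the previous reference value and of the potential,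
  either \<open>s \<le> a / 2\<close>, so \<open>R k - R\<^sub>*\<close> shrinks by a fixed factor and its square root bounds the step,
  or \<open>s > a / 2\<close>, and KL applies with the desingularizing function \<open>\<phi> (t / 2)\<close>. In both cases the
  step is at most a quarter of the two preceding steps plus a telescoping difference, so the
  iterates never leave the neighbourhood again and converge.\<close>

section \<open>Subdifferentials\<close>

text \<open>Clearing the denominator turns the liminf of quotients into affine minorants with error
  \<open>e * norm (z - y)\<close>. At \<open>z = y\<close> this is an equality, so
  \<open>nhds y\<close> can replace the punctured filter. All later arguments use this form.\<close>

lemma frechet_subdiff_iff:
  fixes h :: "'a::real_inner \<Rightarrow> ereal"
  shows "d \<in> frechet_subdiff h y \<longleftrightarrow> \<bar>h y\<bar> \<noteq> \<infinity> \<and>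
    (\<forall>e>0. \<forall>\<^sub>F z in nhds y. h y + ereal (d \<bullet> (z - y) - e * norm (z - y)) \<le> h z)"
proof (cases "\<bar>h y\<bar> = \<infinity>")
  case False
  then obtain r where r: "h y = ereal r" by auto
  have quot: "ereal c < (h z - h y - ereal (d \<bullet> (z - y))) / ereal (norm (z - y)) \<longleftrightarrow>
      h y + ereal (d \<bullet> (z - y) + c * norm (z - y)) < h z" if "z \<noteq> y" for c z
  proof -
    have "norm (z - y) > 0" using that by simp
    then show ?thesis
      by (cases "h z") (auto simp: r field_simps)
  qed
  have "0 \<le> Liminf (at y) (\<lambda>z. (h z - h y - ereal (d \<bullet> (z - y))) / ereal (norm (z - y))) \<longleftrightarrow>
      (\<forall>e>0. \<forall>\<^sub>F z in nhds y. h y + ereal (d \<bullet> (z - y) - e * norm (z - y)) \<le> h z)"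
    (is "?L \<longleftrightarrow> ?R")
  proof
    assume L: ?L
    show ?R
    proof (intro allI impI)
      fix e :: real assume "e > 0"
      then have "ereal (- e) < 0" by simp
      with L have "\<forall>\<^sub>F z in at y. ereal (- e) < (h z - h y - ereal (d \<bullet> (z - y))) / ereal (norm (z - y))"
        unfolding le_Liminf_iff by blast
      then have "\<forall>\<^sub>F z in at y. h y + ereal (d \<bullet> (z - y) - e * norm (z - y)) \<le> h z"
        unfolding eventually_at_filter
        by eventually_elim (use quot[of _ "- e"] in \<open>auto intro: less_imp_le\<close>)
      then show "\<forall>\<^sub>F z in nhds y. h y + ereal (d \<bullet> (z - y) - e * norm (z - y)) \<le> h z"
        unfolding eventually_at_filter
        by eventually_elim (auto simp: r)
    qed
  next
    assume R: ?R
    show ?L unfolding le_Liminf_iff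
    proof (intro allI impI)
      fix c :: ereal assume "c < 0"
      then obtain e where e: "e > 0" "c < ereal (- e)"
        by (metis ereal_dense2 ereal_less(2) less_ereal.simps(1) neg_0_less_iff_less minus_minus zero_ereal_def)
      \<comment> \<open>Half of \<open>e\<close> leaves a strict gap, as the characterization of
        \<open>Liminf\<close> asks for strict inequalities.\<close>
      with R have "\<forall>\<^sub>F z in nhds y. h y + ereal (d \<bullet> (z - y) - (e / 2) * norm (z - y)) \<le> h z"
        using half_gt_zero by blast
      then show "\<forall>\<^sub>F z in at y. c < (h z - h y - ereal (d \<bullet> (z - y))) / ereal (norm (z - y))"
        unfolding eventually_at_filter
      proof eventually_elim
        case (elim z)
        show ?case
        proof (intro impI)
          assume "z \<noteq> y"
          then have "h y + ereal (d \<bullet> (z - y) + (- e) * norm (z - y)) <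
              h y + ereal (d \<bullet> (z - y) - (e / 2) * norm (z - y))"
            using e by (simp add: r)
          with elim quot[OF \<open>z \<noteq> y\<close>, of "- e"] e(2)
          show "c < (h z - h y - ereal (d \<bullet> (z - y))) / ereal (norm (z - y))"
            by (meson less_le_trans less_trans)
        qed
      qed
    qed
  qed
  then show ?thesis by (simp add: frechet_subdiff_def)
qed (simp add: frechet_subdiff_def)

text \<open>Half of the error \<open>e\<close> goes to \<open>h\<close>, half to the linearization
  of \<open>s\<close>. Applied to the negative of a smooth summand, the same inclusion removes that
  summand again.\<close>

lemma frechet_subdiff_add_smooth:
  fixes h :: "'a::real_inner \<Rightarrow> ereal"
  assumes d: "d \<in> frechet_subdiff h y" and s: "(s has_derivative (\<lambda>z. v \<bullet> z)) (at y)"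
  shows "d + v \<in> frechet_subdiff (\<lambda>z. h z + ereal (s z)) y"
proof -
  from d obtain r where r: "h y = ereal r" by (auto simp: frechet_subdiff_iff)
  show ?thesis unfolding frechet_subdiff_iff
  proof (intro conjI allI impI)
    fix e :: real assume "e > 0"
    then have "\<forall>\<^sub>F z in nhds y. h y + ereal (d \<bullet> (z - y) - e / 2 * norm (z - y)) \<le> h z"
      using d half_gt_zero unfolding frechet_subdiff_iff by blast
    moreover have "\<forall>\<^sub>F z in nhds y. norm (s z - s y - v \<bullet> (z - y)) \<le> e / 2 * norm (z - y)"
      using s \<open>e > 0\<close> unfolding has_derivative_at_alt eventually_nhds_metric dist_norm
      using half_gt_zero by blast
    ultimately show "\<forall>\<^sub>F z in nhds y. h y + ereal (s y) + ereal ((d + v) \<bullet> (z - y) - e * norm (z - y))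
        \<le> h z + ereal (s z)"
    proof eventually_elim
      case (elim z)
      then have "- (e / 2 * norm (z - y)) \<le> s z - s y - v \<bullet> (z - y)"
        unfolding real_norm_def by linarith
      with elim(1) show ?case
        by (cases "h z") (auto simp: r inner_add_left)
    qed
  qed (simp add: r)
qed

text \<open>The norm of a component is at most the norm of the pair, so the error term only grows
  when further variables are added.\<close>

lemma frechet_subdiff_fst:
  fixes h :: "'a::real_inner \<Rightarrow> ereal" and w :: "'b::real_inner"
  assumes "d \<in> frechet_subdiff h u"
  shows "(d, 0) \<in> frechet_subdiff (\<lambda>z. h (fst z)) (u, w)"
  unfolding frechet_subdiff_iff
proof (intro conjI allI impI)
  fix e :: real assume "e > 0"
  then have "\<forall>\<^sub>F z in nhds u. h u + ereal (d \<bullet> (z - u) - e * norm (z - u)) \<le> h z"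
    using assms unfolding frechet_subdiff_iff by blast
  moreover have "filterlim fst (nhds u) (nhds (u, w))"
    using tendsto_fst[OF filterlim_ident, of "(u, w)"] by simp
  ultimately have "\<forall>\<^sub>F z in nhds (u, w). h u + ereal (d \<bullet> (fst z - u) - e * norm (fst z - u)) \<le> h (fst z)"
    unfolding filterlim_iff by blast
  then show "\<forall>\<^sub>F z in nhds (u, w). h (fst (u, w)) + ereal ((d, 0) \<bullet> (z - (u, w)) - e * norm (z - (u, w))) \<le> h (fst z)"
  proof eventually_elim
    case (elim z)
    have "norm (fst z - u) \<le> norm (z - (u, w))"
      by (metis diff_Pair fst_conv norm_fst_le prod.collapse)
    then have "e * norm (fst z - u) \<le> e * norm (z - (u, w))"
      using \<open>e > 0\<close> by simp
    then have "h u + ereal ((d, 0) \<bullet> (z - (u, w)) - e * norm (z - (u, w)))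
        \<le> h u + ereal (d \<bullet> (fst z - u) - e * norm (fst z - u))"
      by (intro add_left_mono) (cases z, simp)
    with elim show ?case by simp
  qed
qed (use assms in \<open>simp add: frechet_subdiff_iff\<close>)

lemma frechet_subdiff_subset_limiting:
  "frechet_subdiff h x \<subseteq> limiting_subdiff h x"
proof
  fix d assume "d \<in> frechet_subdiff h x"
  moreover from this have "\<bar>h x\<bar> \<noteq> \<infinity>" by (simp add: frechet_subdiff_iff)
  ultimately show "d \<in> limiting_subdiff h x"
    unfolding limiting_subdiff_def mem_Collect_eq
    by (intro conjI exI[of _ "\<lambda>_. x"] exI[of _ "\<lambda>_. d"]) auto
qed

lemma global_minimizer_frechet:
  fixes h :: "'a::real_inner \<Rightarrow> ereal"
  assumes "\<bar>h y\<bar> \<noteq> \<infinity>" "\<And>z. h y \<le> h z"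
  shows "0 \<in> frechet_subdiff h y"
  unfolding frechet_subdiff_iff
proof (intro conjI allI impI always_eventually)
  fix e :: real and z assume "e > 0"
  then have "h y + ereal (0 \<bullet> (z - y) - e * norm (z - y)) \<le> h y"
    using assms(1) by (cases "h y") auto
  with assms(2) show "h y + ereal (0 \<bullet> (z - y) - e * norm (z - y)) \<le> h z"
    by (meson order_trans)
qed (use assms in auto)

text \<open>A Frechet subgradient satisfies its inequality up to \<open>e'\<close> near
  \<open>y\<close>. Along the segment from \<open>y\<close> to \<open>z\<close>, convexity makes
  every term proportional to \<open>t\<close>, and dividing by \<open>t\<close> gives the inequality
  at \<open>z\<close> itself. Such global inequalities survive limits, so the limiting
  subdifferential is the convex one.\<close>

lemma limiting_subdiff_convex_iff:
  fixes h :: "'a::real_inner \<Rightarrow> real"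
  assumes "convex_on UNIV h"
  shows "d \<in> limiting_subdiff (\<lambda>z. ereal (h z)) x \<longleftrightarrow> (\<forall>z. h x + d \<bullet> (z - x) \<le> h z)"
proof
  assume "\<forall>z. h x + d \<bullet> (z - x) \<le> h z"
  then have "d \<in> frechet_subdiff (\<lambda>z. ereal (h z)) x"
    unfolding frechet_subdiff_iff
    by (auto intro!: always_eventually) (smt (verit) mult_nonneg_nonneg norm_ge_zero)
  then show "d \<in> limiting_subdiff (\<lambda>z. ereal (h z)) x"
    using frechet_subdiff_subset_limiting by blast
next
  have frechet: "h y + d \<bullet> (z - y) \<le> h z"
    if d: "d \<in> frechet_subdiff (\<lambda>z. ereal (h z)) y" for d y z
  proof (rule field_le_epsilon)
    fix e :: real assume "e > 0"
    \<comment> \<open>Chosen so that \<open>e' * norm (z - y) \<le> e\<close>; adding 1 covers the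
      case \<open>z = y\<close>.\<close>
    define e' where "e' = e / (norm (z - y) + 1)"
    have n1: "norm (z - y) + 1 > 0" by (simp add: add_nonneg_pos)
    have "e' > 0" using \<open>e > 0\<close> n1 by (simp add: e'_def)
    then have "\<forall>\<^sub>F w in nhds y. h y + (d \<bullet> (w - y) - e' * norm (w - y)) \<le> h w"
      using d by (auto simp: frechet_subdiff_iff)
    moreover have "((\<lambda>t. y + t *\<^sub>R (z - y)) \<longlongrightarrow> y) (at_right (0::real))"
      by (auto intro!: tendsto_eq_intros)
    ultimately have "\<forall>\<^sub>F t in at_right 0. h y + (d \<bullet> (t *\<^sub>R (z - y)) - e' * norm (t *\<^sub>R (z - y))) \<le> h (y + t *\<^sub>R (z - y))"
      unfolding filterlim_iff by fastforce
    moreover have "\<forall>\<^sub>F t in at_right (0::real). t \<in> {0<..<1}"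
      by (rule eventually_at_right_real) simp
    ultimately have "\<forall>\<^sub>F t in at_right (0::real). h y + d \<bullet> (z - y) \<le> h z + e"
    proof eventually_elim
      case (elim t)
      have "h (y + t *\<^sub>R (z - y)) = h ((1 - t) *\<^sub>R y + t *\<^sub>R z)"
        by (simp add: algebra_simps)
      also have "\<dots> \<le> (1 - t) * h y + t * h z"
        using elim(2) by (intro convex_onD[OF assms]) auto
      finally have "h (y + t *\<^sub>R (z - y)) \<le> (1 - t) * h y + t * h z" .
      moreover have "d \<bullet> (t *\<^sub>R (z - y)) - e' * norm (t *\<^sub>R (z - y)) =
          t * (d \<bullet> (z - y) - e' * norm (z - y))"
        using elim(2) by (simp add: right_diff_distrib mult.left_commute)
      ultimately have "t * (d \<bullet> (z - y) - e' * norm (z - y)) \<le> t * (h z - h y)"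
        using elim(1) unfolding left_diff_distrib right_diff_distrib by linarith
      then have "d \<bullet> (z - y) - e' * norm (z - y) \<le> h z - h y"
        using elim(2) by simp
      moreover have "e' * norm (z - y) \<le> e"
        using n1 \<open>e > 0\<close> by (simp add: e'_def field_simps)
      ultimately show ?case by simp
    qed
    then show "h y + d \<bullet> (z - y) \<le> h z + e" by simp
  qed
  assume "d \<in> limiting_subdiff (\<lambda>z. ereal (h z)) x"
  then obtain X D where X: "X \<longlonglongrightarrow> x" "(\<lambda>k. h (X k)) \<longlonglongrightarrow> h x" "D \<longlonglongrightarrow> d"
    and D: "\<And>k. D k \<in> frechet_subdiff (\<lambda>z. ereal (h z)) (X k)"
    by (auto simp: limiting_subdiff_def)
  show "\<forall>z. h x + d \<bullet> (z - x) \<le> h z"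
  proof
    fix z
    have "(\<lambda>k. h (X k) + D k \<bullet> (z - X k)) \<longlonglongrightarrow> h x + d \<bullet> (z - x)"
      by (intro tendsto_intros X)
    then show "h x + d \<bullet> (z - x) \<le> h z"
      by (rule LIMSEQ_le_const2) (use frechet[OF D] in blast)
  qed
qed

text \<open>The function \<open>h z - d \<bullet> z\<close> has a global minimum at
  \<open>x\<close>, so its derivative vanishes there.\<close>

lemma subgradient_eq_gradient:
  fixes h :: "'a::real_inner \<Rightarrow> real"
  assumes "GDERIV h x :> v" "\<And>z. h x + d \<bullet> (z - x) \<le> h z"
  shows "d = v"
proof -
  have "((\<lambda>z. h z - d \<bullet> z) has_derivative (\<lambda>z. (v - d) \<bullet> z)) (at x)"
    using assms(1) unfolding gderiv_def
    by (auto intro!: derivative_eq_intros simp: inner_diff_left inner_commute[of v])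
  then have "(\<lambda>z. (v - d) \<bullet> z) = (\<lambda>z. 0)"
    using assms(2) by (intro differential_zero_maxmin[of x UNIV])
      (auto simp: algebra_simps intro!: disjI2)
  then have "(v - d) \<bullet> (v - d) = 0" by metis
  then show ?thesis by simp
qed

section \<open>Semicontinuity and proximal minimizers\<close>

text \<open>\<open>lsc\<close> speaks of the punctured filter, but the sequence may hit
  \<open>x\<close>; there the bound holds by assumption.\<close>

lemma lsc_eventually:
  fixes h :: "'a::topological_space \<Rightarrow> ereal"
  assumes "lsc h" "X \<longlonglongrightarrow> x" "a < h x"
  shows "\<forall>\<^sub>F n in sequentially. a < h (X n)"
proof -
  have "\<forall>\<^sub>F z in at x. a < h z"
    using assms(1,3) unfolding lsc_def le_Liminf_iff by blast
  then have "\<forall>\<^sub>F z in nhds x. a < h z"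
    unfolding eventually_at_filter by eventually_elim (use assms(3) in auto)
  then show ?thesis
    using assms(2) unfolding filterlim_iff by blast
qed

lemma lsc_le_limit:
  fixes h :: "'a::topological_space \<Rightarrow> ereal"
  assumes "lsc h" "X \<longlonglongrightarrow> x" "\<forall>\<^sub>F n in sequentially. h (X n) \<le> c n" "c \<longlonglongrightarrow> l"
  shows "h x \<le> l"
proof (rule ccontr)
  assume "\<not> h x \<le> l"
  then have "l < h x" by simp
  then obtain a where a: "l < a" "a < h x" using dense by blast
  have "\<forall>\<^sub>F n in sequentially. a < h (X n)"
    using assms(1,2) a(2) by (rule lsc_eventually)
  moreover have "\<forall>\<^sub>F n in sequentially. c n < a"
    using assms(4) a(1) by (rule order_tendstoD)
  ultimately have "\<forall>\<^sub>F n in sequentially. False"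
    using assms(3) by eventually_elim auto
  then show False by simp
qed

text \<open>Lower semicontinuity gives one half of the limit; the majorants \<open>c\<close> supply
  the other.\<close>

lemma lsc_tendsto:
  fixes h :: "'a::topological_space \<Rightarrow> ereal"
  assumes "lsc h" "X \<longlonglongrightarrow> x" "\<And>n. h (X n) \<le> c n" "c \<longlonglongrightarrow> h x"
  shows "(\<lambda>n. h (X n)) \<longlonglongrightarrow> h x"
proof (rule order_tendstoI)
  fix a assume "h x < a"
  with assms(4) have "\<forall>\<^sub>F n in sequentially. c n < a" by (rule order_tendstoD)
  then show "\<forall>\<^sub>F n in sequentially. h (X n) < a"
    by eventually_elim (use assms(3) le_less_trans in blast)
qed (use assms lsc_eventually in blast)

lemma prox_bounded_lower:
  assumes "prox_bounded h"
  obtains c B where "c > 0" "\<And>z. ereal (- B - c / 2 * (norm z)\<^sup>2) \<le> h z"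
proof -
  obtain c where c: "c > 0" "(INF x. h x + ereal (c / 2 * (norm x)\<^sup>2)) > - \<infinity>"
    using assms unfolding prox_bounded_def by auto
  then obtain B where B: "ereal B < (INF x. h x + ereal (c / 2 * (norm x)\<^sup>2))"
    using ereal_dense2 by blast
  have "ereal (- (- B) - c / 2 * (norm z)\<^sup>2) \<le> h z" for z
  proof -
    have "ereal B \<le> h z + ereal (c / 2 * (norm z)\<^sup>2)"
      using B by (meson INF_lower UNIV_I less_imp_le less_le_trans)
    then show ?thesis by (cases "h z") auto
  qed
  with c(1) show thesis by (rule that)
qed

text \<open>Completing the square: the quadratic coefficient that is left is
  \<open>(\<gamma> - c) / 2\<close>. One half of it absorbs the linear term, the other half remains
  as growth.\<close>

lemma quadratic_coercive:
  fixes y v :: "'a::real_inner"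
  assumes "c < \<gamma>"
  obtains K where "\<And>z. K + (\<gamma> - c) / 4 * (norm z)\<^sup>2 \<le> v \<bullet> (z - y) + \<gamma> / 2 * (norm (z - y))\<^sup>2 - c / 2 * (norm z)\<^sup>2"
proof -
  define \<kappa> where "\<kappa> = (\<gamma> - c) / 4"
  define u where "u = v - \<gamma> *\<^sub>R y"
  have "\<kappa> > 0" using assms by (simp add: \<kappa>_def)
  have "(\<gamma> / 2 * (norm y)\<^sup>2 - v \<bullet> y - (norm u)\<^sup>2 / (4 * \<kappa>)) + (\<gamma> - c) / 4 * (norm z)\<^sup>2
      \<le> v \<bullet> (z - y) + \<gamma> / 2 * (norm (z - y))\<^sup>2 - c / 2 * (norm z)\<^sup>2" for z
  proof -
    have "0 \<le> \<kappa> * (norm (z + (1 / (2 * \<kappa>)) *\<^sub>R u))\<^sup>2"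
      using \<open>\<kappa> > 0\<close> by simp
    also have "\<dots> = \<kappa> * (norm z)\<^sup>2 + u \<bullet> z + (norm u)\<^sup>2 / (4 * \<kappa>)"
      using \<open>\<kappa> > 0\<close> unfolding power2_norm_eq_inner
      by (simp add: inner_add_left inner_add_right inner_commute[of z u] field_simps power2_eq_square)
    also have "u \<bullet> z = v \<bullet> z - \<gamma> * (y \<bullet> z)" by (simp add: u_def inner_diff_left)
    finally have *: "0 \<le> \<kappa> * (norm z)\<^sup>2 + (v \<bullet> z - \<gamma> * (y \<bullet> z)) + (norm u)\<^sup>2 / (4 * \<kappa>)" .
    have "(norm (z - y))\<^sup>2 = (norm z)\<^sup>2 - 2 * (y \<bullet> z) + (norm y)\<^sup>2"
      unfolding power2_norm_eq_inner by (simp add: inner_diff_left inner_diff_right inner_commute)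
    then have "\<gamma> / 2 * (norm (z - y))\<^sup>2 = \<gamma> / 2 * (norm z)\<^sup>2 - \<gamma> * (y \<bullet> z) + \<gamma> / 2 * (norm y)\<^sup>2"
      by (simp only: distrib_left right_diff_distrib)
    moreover have "\<gamma> / 2 * (norm z)\<^sup>2 = c / 2 * (norm z)\<^sup>2 + 2 * (\<kappa> * (norm z)\<^sup>2)"
      "(\<gamma> - c) / 4 * (norm z)\<^sup>2 = \<kappa> * (norm z)\<^sup>2"
      by (simp_all add: \<kappa>_def field_simps)
    ultimately show ?thesis using * unfolding inner_diff_right by linarith
  qed
  then show thesis by (rule that)
qed

text \<open>The direct method: prox-boundedness and \<open>c < \<gamma>\<close> make the model
  coercive, a minimizing sequence is bounded, and lower semicontinuity passes to the limit. Hence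
  only trials with small \<open>\<gamma>\<close> can fail for lack of a minimizer.\<close>

lemma model_minimizer_exists:
  fixes P1 :: "'a::euclidean_space \<Rightarrow> ereal"
  assumes "lsc P1" "proper_fun P1" and lower: "\<And>z. ereal (- B - c / 2 * (norm z)\<^sup>2) \<le> P1 z" and "c < \<gamma>"
  shows "\<exists>z. is_arg_min (nexPGA_model g P1 \<xi> y \<gamma>) (\<lambda>_. True) z"
proof -
  define q where "q z = (g y - \<xi>) \<bullet> (z - y) + \<gamma> / 2 * (norm (z - y))\<^sup>2" for z
  define m where "m z = ereal (q z) + P1 z" for z
  have m_eq: "nexPGA_model g P1 \<xi> y \<gamma> = m"
    by (simp add: fun_eq_iff m_def q_def nexPGA_model_def)
  obtain K where K: "\<And>z. K + (\<gamma> - c) / 4 * (norm z)\<^sup>2 \<le> q z - c / 2 * (norm z)\<^sup>2"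
    using quadratic_coercive[OF \<open>c < \<gamma>\<close>, of "g y - \<xi>" y] unfolding q_def by metis
  have coercive: "ereal (K - B + (\<gamma> - c) / 4 * (norm z)\<^sup>2) \<le> m z" for z
    using K[of z] lower[of z] unfolding m_def by (cases "P1 z") auto
  obtain u where u: "\<And>n. u n \<in> range m" "u \<longlonglongrightarrow> Inf (range m)"
    using Inf_as_limit[of "range m"] by blast
  then have "\<forall>n. \<exists>z. u n = m z" by blast
  then obtain Z where Z: "\<And>n. u n = m (Z n)" by metis
  obtain z0 where "P1 z0 < \<infinity>" using assms(2) by (auto simp: proper_fun_def effdom_def)
  then have "m z0 < \<infinity>" by (cases "P1 z0") (auto simp: m_def)
  then have "Inf (range m) < \<infinity>" by (meson INF_lower UNIV_I le_less_trans)
  then obtain M where M: "Inf (range m) < ereal M" using ereal_dense2 by blast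
  moreover have "ereal (K - B) \<le> Inf (range m)"
  proof (rule INF_greatest)
    fix z :: 'a
    have "K - B \<le> K - B + (\<gamma> - c) / 4 * (norm z)\<^sup>2" using \<open>c < \<gamma>\<close> by simp
    then show "ereal (K - B) \<le> m z" using coercive[of z] by (meson ereal_less_eq(3) order_trans)
  qed
  ultimately obtain I where I: "Inf (range m) = ereal I" by (cases "Inf (range m)") auto
  have "\<forall>\<^sub>F n in sequentially. u n < ereal M"
    using u(2) M by (rule order_tendstoD)
  then obtain n0 where n0: "\<And>n. n \<ge> n0 \<Longrightarrow> m (Z n) < ereal M"
    unfolding eventually_sequentially Z by auto
  \<comment> \<open>Radius obtained by solving
    \<open>K - B + (\<gamma> - c) / 4 * t\<^sup>2 \<le> M\<close> for \<open>t\<close>.\<close>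
  define r where "r = sqrt (4 * (M - K + B) / (\<gamma> - c))"
  have "Z (n + n0) \<in> cball 0 r" for n
  proof -
    have "ereal (K - B + (\<gamma> - c) / 4 * (norm (Z (n + n0)))\<^sup>2) < ereal M"
      using coercive[of "Z (n + n0)"] n0[of "n + n0"] by (meson le_add2 le_less_trans)
    then have "(norm (Z (n + n0)))\<^sup>2 \<le> 4 * (M - K + B) / (\<gamma> - c)"
      using \<open>c < \<gamma>\<close> by (simp add: field_simps)
    then show ?thesis by (simp add: r_def real_le_rsqrt)
  qed
  then obtain z s where s: "strict_mono s" "((\<lambda>n. Z (n + n0)) \<circ> s) \<longlonglongrightarrow> z"
    using seq_compactE[of "cball 0 r" "\<lambda>n. Z (n + n0)"] compact_imp_seq_compact[OF compact_cball]
    by blast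
  define X where "X n = Z (s n + n0)" for n
  have X: "X \<longlonglongrightarrow> z" using s(2) by (simp only: X_def [abs_def] comp_def)
  have "(\<lambda>n. u (s n + n0)) \<longlonglongrightarrow> Inf (range m)"
    using LIMSEQ_subseq_LIMSEQ[OF LIMSEQ_ignore_initial_segment[OF u(2), of n0] s(1)] by (simp add: comp_def)
  then have mX: "(\<lambda>n. m (X n)) \<longlonglongrightarrow> ereal I" by (simp add: I Z X_def)
  have "q \<midarrow>z\<rightarrow> q z" unfolding q_def by (intro tendsto_intros)
  then have "(\<lambda>n. q (X n)) \<longlonglongrightarrow> q z"
    using X by (simp add: isCont_tendsto_compose isCont_def)
  then have "(\<lambda>n. m (X n) - ereal (q (X n))) \<longlonglongrightarrow> ereal I - ereal (q z)"
    using mX by (intro tendsto_diff_ereal) auto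
  moreover have "P1 (X n) \<le> m (X n) - ereal (q (X n))" for n
    by (cases "P1 (X n)") (auto simp: m_def)
  ultimately have "P1 z \<le> ereal I - ereal (q z)"
    by (intro lsc_le_limit[OF \<open>lsc P1\<close> X always_eventually]) auto
  then have "m z \<le> Inf (range m)" unfolding m_def I by (cases "P1 z") auto
  then have "\<not> m w < m z" for w
    by (meson INF_lower UNIV_I le_less_trans less_le_not_le)
  then show ?thesis by (auto simp: is_arg_min_def m_eq)
qed

section \<open>Uniform KL inequality\<close>

text \<open>\<open>\<psi>\<close> stands for the derivative of \<open>\<phi>\<close>, but only the
  tangent inequality of a concave function is kept, with \<open>b = 0\<close> allowed. This form is
  closed under sums, and no derivative has to be recomputed.\<close>

definition desing_pair :: "real \<Rightarrow> (real \<Rightarrow> real) \<Rightarrow> (real \<Rightarrow> real) \<Rightarrow> bool"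
  where "desing_pair \<nu> \<phi> \<psi> \<longleftrightarrow> \<phi> 0 = 0 \<and> (\<phi> \<longlongrightarrow> 0) (at_right 0) \<and>
    (\<forall>a. 0 < a \<and> a < \<nu> \<longrightarrow> 0 < \<psi> a) \<and>
    (\<forall>a b. 0 < a \<and> a < \<nu> \<and> 0 \<le> b \<and> b < \<nu> \<longrightarrow> \<psi> a * (a - b) \<le> \<phi> a - \<phi> b)"

lemma desing_pair_mono:
  "desing_pair \<nu> \<phi> \<psi> \<Longrightarrow> \<nu>' \<le> \<nu> \<Longrightarrow> desing_pair \<nu>' \<phi> \<psi>"
  unfolding desing_pair_def by auto

lemma desing_pair_add:
  assumes "desing_pair \<nu> \<phi>1 \<psi>1" "desing_pair \<nu> \<phi>2 \<psi>2"
  shows "desing_pair \<nu> (\<lambda>s. \<phi>1 s + \<phi>2 s) (\<lambda>s. \<psi>1 s + \<psi>2 s)"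
  using assms unfolding desing_pair_def
  by (auto simp: distrib_right add_pos_pos intro: tendsto_add_zero) (smt (verit))

text \<open>Add the tangent inequalities at \<open>a\<close> and at \<open>b\<close>.\<close>

lemma desing_pair_antimono:
  assumes "desing_pair \<nu> \<phi> \<psi>" "0 < a" "a \<le> b" "b < \<nu>"
  shows "\<psi> b \<le> \<psi> a"
proof (cases "a = b")
  case False
  then have "\<psi> b * (b - a) \<le> \<phi> b - \<phi> a" "\<psi> a * (a - b) \<le> \<phi> a - \<phi> b"
    using assms unfolding desing_pair_def by auto
  then have "\<psi> b * (b - a) \<le> \<psi> a * (b - a)" by (simp add: algebra_simps)
  then show ?thesis using False assms by simp
qed simp

lemma desing_pair_mono_fun:
  assumes "desing_pair \<nu> \<phi> \<psi>" "0 \<le> a" "a \<le> b" "b < \<nu>"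
  shows "\<phi> a \<le> \<phi> b"
proof (cases "a = b")
  case False
  then have "0 < \<psi> b" "\<psi> b * (b - a) \<le> \<phi> b - \<phi> a"
    using assms unfolding desing_pair_def by auto
  moreover have "0 \<le> \<psi> b * (b - a)" using calculation assms by simp
  ultimately show ?thesis by simp
qed simp

text \<open>The sequence may take the value 0, which \<open>at_right 0\<close> excludes; there
  \<open>\<phi> 0 = 0\<close> helps.\<close>

lemma desing_pair_tendsto:
  assumes "desing_pair \<nu> \<phi> \<psi>" "r \<longlonglongrightarrow> 0" "\<And>k. 0 \<le> r k"
  shows "(\<lambda>k. \<phi> (r k)) \<longlonglongrightarrow> 0"
proof -
  have "\<phi> 0 = 0" "(\<phi> \<longlongrightarrow> 0) (at_right 0)" using assms(1) by (auto simp: desing_pair_def)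
  then have "(\<phi> \<longlongrightarrow> \<phi> 0) (at 0 within {0..})"
    by (metis at_within_Ici_at_right)
  then have "(\<phi> \<longlongrightarrow> \<phi> 0) (inf (nhds 0) (principal {0..}))"
    using tendsto_at_within_iff_tendsto_nhds by blast
  moreover have "filterlim r (inf (nhds 0) (principal {0..})) sequentially"
    using assms(2,3) by (auto simp: filterlim_inf filterlim_principal)
  ultimately show ?thesis using \<open>\<phi> 0 = 0\<close> filterlim_compose by fastforce
qed

lemma desingularizing_imp_pair:
  assumes "0 < \<nu>" "\<phi> \<in> desingularizing \<nu>"
  obtains \<nu>' where "\<nu>' > 0" "ereal \<nu>' \<le> \<nu>" "desing_pair \<nu>' \<phi> (deriv \<phi>)"
proof -
  \<comment> \<open>\<open>\<nu>\<close> may be infinite. A finite \<open>\<nu>'\<close> strictly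
    below it gives a real interval inside the domain of \<open>\<phi>\<close>.\<close>
  obtain \<nu>' where \<nu>': "0 < ereal \<nu>'" "ereal \<nu>' < \<nu>" using ereal_dense2[OF \<open>0 < \<nu>\<close>] by blast
  have sub: "{0..<\<nu>'} \<subseteq> {s. 0 \<le> s \<and> ereal s < \<nu>}"
    using \<nu>'(2) by (auto elim: less_trans[rotated])
  have "continuous (at 0 within {0..<\<nu>'}) \<phi>"
    using assms(2) sub by (auto simp: desingularizing_def intro: continuous_within_subset)
  then have "(\<phi> \<longlongrightarrow> \<phi> 0) (at 0 within {0..<\<nu>'})" by (simp add: continuous_within)
  then have "(\<phi> \<longlongrightarrow> \<phi> 0) (at 0 within {0..\<nu>' / 2})"
    by (rule tendsto_within_subset) (use \<nu>' in auto)
  moreover have "at 0 within {0..\<nu>' / 2} = at_right (0::real)"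
    using \<nu>' by (intro at_within_Icc_at_right) auto
  ultimately have lim: "(\<phi> \<longlongrightarrow> 0) (at_right 0)" using assms(2) by (simp add: desingularizing_def)
  have "convex_on {s. 0 \<le> s \<and> ereal s < \<nu>} (\<lambda>s. - \<phi> s)"
    using assms(2) by (simp add: desingularizing_def concave_on_def)
  then have conv: "convex_on {0..<\<nu>'} (\<lambda>s. - \<phi> s)"
    using convex_on_subset sub convex_real_interval by blast
  have "deriv \<phi> a * (a - b) \<le> \<phi> a - \<phi> b" if "0 < a" "a < \<nu>'" "0 \<le> b" "b < \<nu>'" for a b
  proof -
    have "ereal a < \<nu>" using that \<nu>'(2) by (meson ereal_less(2) less_ereal.simps(1) less_trans)
    then have "\<phi> differentiable at a" using assms(2) that by (simp add: desingularizing_def)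
    then have "(\<phi> has_real_derivative deriv \<phi> a) (at a)" by (simp add: DERIV_deriv_iff_real_differentiable)
    then have "((\<lambda>s. - \<phi> s) has_real_derivative - deriv \<phi> a) (at a within {0..<\<nu>'})"
      by (intro DERIV_minus) (rule has_field_derivative_at_within)
    moreover have "a \<in> interior {0..<\<nu>'}"
      using that by (intro interiorI[of "{0<..<\<nu>'}"]) auto
    ultimately have "- \<phi> b - - \<phi> a \<ge> - deriv \<phi> a * (b - a)"
      using that by (intro convex_on_imp_above_tangent[OF conv]) auto
    then show ?thesis by (simp add: algebra_simps)
  qed
  moreover have "0 < deriv \<phi> a" if "0 < a" "a < \<nu>'" for a
  proof -
    have "ereal a < \<nu>" using that \<nu>'(2) by (meson ereal_less(2) less_ereal.simps(1) less_trans)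
    then show ?thesis using assms(2) that by (simp add: desingularizing_def)
  qed
  ultimately have "desing_pair \<nu>' \<phi> (deriv \<phi>)"
    using lim assms(2) by (simp add: desing_pair_def desingularizing_def)
  with \<nu>' show thesis by (intro that[of \<nu>']) auto
qed

text \<open>The KL inequality with one \<open>\<psi>\<close> for all parameters in
  \<open>{a..b}\<close>, and with the norm of a Frechet subgradient in place of the distance to the
  limiting subdifferential: the subgradients produced at the iterates are Frechet ones.\<close>

definition uniform_KL ::
  "('a::real_inner \<times> 'a \<times> real \<Rightarrow> ereal) \<Rightarrow> 'a \<Rightarrow> real \<Rightarrow> real \<Rightarrow> real \<Rightarrow> real \<Rightarrow> real \<Rightarrow> (real \<Rightarrow> real) \<Rightarrow> bool"
  where "uniform_KL h w c a b \<rho> \<nu> \<psi> \<longleftrightarrow>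
    (\<forall>u v \<gamma> d s. dist u w < \<rho> \<and> dist v w < \<rho> \<and> \<gamma> \<in> {a..b} \<and> h (u, v, \<gamma>) = ereal s \<and>
      c < s \<and> s < c + \<nu> \<and> d \<in> frechet_subdiff h (u, v, \<gamma>) \<longrightarrow> 1 \<le> \<psi> (s - c) * norm d)"

lemma uniform_KLD:
  assumes "uniform_KL h w c a b \<rho> \<nu> \<psi>" "dist u w < \<rho>" "dist v w < \<rho>" "\<gamma> \<in> {a..b}"
    "h (u, v, \<gamma>) = ereal s" "c < s" "s < c + \<nu>" "d \<in> frechet_subdiff h (u, v, \<gamma>)"
  shows "1 \<le> \<psi> (s - c) * norm d"
  using assms unfolding uniform_KL_def by blast

text \<open>The KL neighbourhood contains a box around the point. Frechet subgradients are limiting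
  ones, so their norms bound the distance from above.\<close>

lemma KL_at_uniform:
  fixes h :: "'a::real_inner \<times> 'a \<times> real \<Rightarrow> ereal"
  assumes "KL_at h (w, w, \<gamma>0)" "h (w, w, \<gamma>0) = ereal c"
  obtains \<rho> \<nu> \<phi> \<psi> where "\<rho> > 0" "\<nu> > 0" "desing_pair \<nu> \<phi> \<psi>"
    "uniform_KL h w c (\<gamma>0 - \<rho>) (\<gamma>0 + \<rho>) \<rho> \<nu> \<psi>"
proof -
  obtain \<nu>0 V \<phi> where KL: "0 < \<nu>0" "open V" "(w, w, \<gamma>0) \<in> V" "\<phi> \<in> desingularizing \<nu>0"
    "\<And>x. x \<in> V \<Longrightarrow> ereal c < h x \<Longrightarrow> h x < ereal c + \<nu>0 \<Longrightarrow>
      ereal (deriv \<phi> (real_of_ereal (h x - ereal c))) * edist_to 0 (limiting_subdiff h x) \<ge> 1"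
    using assms unfolding KL_at_def by metis
  obtain \<nu> where \<nu>: "\<nu> > 0" "ereal \<nu> \<le> \<nu>0" "desing_pair \<nu> \<phi> (deriv \<phi>)"
    using desingularizing_imp_pair KL by metis
  obtain A B where AB: "open A" "open B" "w \<in> A" "(w, \<gamma>0) \<in> B" "A \<times> B \<subseteq> V"
    using open_prod_elim[OF KL(2,3)] by (metis mem_Sigma_iff)
  then obtain C D where CD: "open C" "open D" "w \<in> C" "\<gamma>0 \<in> D" "C \<times> D \<subseteq> B"
    using open_prod_elim[of B "(w, \<gamma>0)"] by (metis mem_Sigma_iff)
  \<comment> \<open>A closed ball for the parameter, because \<open>uniform_KL\<close> uses a closed
    interval.\<close>
  obtain r1 r2 r3 where r: "r1 > 0" "ball w r1 \<subseteq> A" "r2 > 0" "ball w r2 \<subseteq> C" "r3 > 0" "cball \<gamma>0 r3 \<subseteq> D"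
    using AB CD by (metis open_contains_ball open_contains_cball)
  define \<rho> where "\<rho> = min r1 (min r2 r3)"
  have "uniform_KL h w c (\<gamma>0 - \<rho>) (\<gamma>0 + \<rho>) \<rho> \<nu> (deriv \<phi>)"
    unfolding uniform_KL_def
  proof (intro allI impI, elim conjE)
    fix u v \<gamma> d s
    assume u: "dist u w < \<rho>" "dist v w < \<rho>" "\<gamma> \<in> {\<gamma>0 - \<rho>..\<gamma>0 + \<rho>}"
      and s: "h (u, v, \<gamma>) = ereal s" "c < s" "s < c + \<nu>" and d: "d \<in> frechet_subdiff h (u, v, \<gamma>)"
    have "u \<in> A" "v \<in> C" using u r by (auto simp: \<rho>_def dist_commute subset_iff)
    moreover have "\<gamma> \<in> D" using u(3) r(6) by (intro subsetD[OF r(6)]) (auto simp: \<rho>_def dist_real_def)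
    ultimately have V: "(u, v, \<gamma>) \<in> V" using AB(5) CD(5) by auto
    have "ereal s < ereal c + ereal \<nu>" using s(3) by simp
    also have "\<dots> \<le> ereal c + \<nu>0" using \<nu>(2) by (intro add_left_mono)
    finally have 1: "1 \<le> ereal (deriv \<phi> (s - c)) * edist_to 0 (limiting_subdiff h (u, v, \<gamma>))"
      using KL(5)[OF V] s by simp
    have pos: "0 < deriv \<phi> (s - c)" using \<nu>(3) s by (auto simp: desing_pair_def)
    have "edist_to 0 (limiting_subdiff h (u, v, \<gamma>)) \<le> ereal (dist 0 d)"
      unfolding edist_to_def using d frechet_subdiff_subset_limiting by (intro INF_lower) blast
    then have "ereal (deriv \<phi> (s - c)) * edist_to 0 (limiting_subdiff h (u, v, \<gamma>))
        \<le> ereal (deriv \<phi> (s - c)) * ereal (norm d)"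
      using pos by (intro ereal_mult_left_mono) auto
    with 1 have "1 \<le> ereal (deriv \<phi> (s - c) * norm d)" by (metis order_trans times_ereal.simps(1))
    then show "1 \<le> deriv \<phi> (s - c) * norm d" by (simp add: one_ereal_def)
  qed
  moreover have "\<rho> > 0" using r by (simp add: \<rho>_def)
  ultimately show thesis using that \<nu> by metis
qed

text \<open>Compactness of the interval: the desingularizing functions of finitely many parameters are added.\<close>

lemma KL_uniformized:
  fixes h :: "'a::real_inner \<times> 'a \<times> real \<Rightarrow> ereal"
  assumes "a \<le> b" and KL: "\<And>\<gamma>. a \<le> \<gamma> \<Longrightarrow> \<gamma> \<le> b \<Longrightarrow> KL_at h (w, w, \<gamma>)"
    and const: "\<And>\<gamma>. a \<le> \<gamma> \<Longrightarrow> \<gamma> \<le> b \<Longrightarrow> h (w, w, \<gamma>) = ereal c"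
  obtains \<rho> \<nu> \<phi> \<psi> where "\<rho> > 0" "\<nu> > 0" "desing_pair \<nu> \<phi> \<psi>" "uniform_KL h w c a b \<rho> \<nu> \<psi>"
proof -
  define Q where "Q \<alpha> \<beta> \<longleftrightarrow> (\<exists>\<rho> \<nu> \<phi> \<psi>. \<rho> > 0 \<and> \<nu> > 0 \<and> desing_pair \<nu> \<phi> \<psi> \<and> uniform_KL h w c \<alpha> \<beta> \<rho> \<nu> \<psi>)"
    for \<alpha> \<beta>
  \<comment> \<open>Bisection: \<open>Q\<close> holds on all short intervals around a point and
    passes to the union of adjacent intervals. For the union, both \<open>\<psi>1\<close> and
    \<open>\<psi>2\<close> are positive, so their sum dominates whichever of them is valid at the
    parameter.\<close>
  have "Q a b"
    using \<open>a \<le> b\<close>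
  proof (induction rule: Bolzano)
    case (trans \<alpha> \<beta> \<gamma>)
    obtain \<rho>1 \<nu>1 \<phi>1 \<psi>1 where 1: "\<rho>1 > 0" "\<nu>1 > 0" "desing_pair \<nu>1 \<phi>1 \<psi>1" "uniform_KL h w c \<alpha> \<beta> \<rho>1 \<nu>1 \<psi>1"
      using trans(1) by (auto simp: Q_def)
    obtain \<rho>2 \<nu>2 \<phi>2 \<psi>2 where 2: "\<rho>2 > 0" "\<nu>2 > 0" "desing_pair \<nu>2 \<phi>2 \<psi>2" "uniform_KL h w c \<beta> \<gamma> \<rho>2 \<nu>2 \<psi>2"
      using trans(2) by (auto simp: Q_def)
    define \<nu> where "\<nu> = min \<nu>1 \<nu>2"
    have pair: "desing_pair \<nu> \<phi>1 \<psi>1" "desing_pair \<nu> \<phi>2 \<psi>2"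
      using 1(3) 2(3) by (auto intro: desing_pair_mono simp: \<nu>_def)
    have "uniform_KL h w c \<alpha> \<gamma> (min \<rho>1 \<rho>2) \<nu> (\<lambda>s. \<psi>1 s + \<psi>2 s)"
      unfolding uniform_KL_def
    proof (intro allI impI, elim conjE)
      fix u v t d s
      assume u: "dist u w < min \<rho>1 \<rho>2" "dist v w < min \<rho>1 \<rho>2" "t \<in> {\<alpha>..\<gamma>}"
        and s: "h (u, v, t) = ereal s" "c < s" "s < c + \<nu>" and d: "d \<in> frechet_subdiff h (u, v, t)"
      have pos: "0 < \<psi>1 (s - c)" "0 < \<psi>2 (s - c)" using pair s by (auto simp: desing_pair_def)
      have "1 \<le> \<psi>1 (s - c) * norm d \<or> 1 \<le> \<psi>2 (s - c) * norm d"
      proof (cases "t \<le> \<beta>")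
        case True
        then have "t \<in> {\<alpha>..\<beta>}" using u by auto
        then have "1 \<le> \<psi>1 (s - c) * norm d"
          using uniform_KLD[OF 1(4) _ _ _ s(1,2) _ d] u s(3) by (simp add: \<nu>_def)
        then show ?thesis ..
      next
        case False
        then have "t \<in> {\<beta>..\<gamma>}" using u by auto
        then have "1 \<le> \<psi>2 (s - c) * norm d"
          using uniform_KLD[OF 2(4) _ _ _ s(1,2) _ d] u s(3) by (simp add: \<nu>_def)
        then show ?thesis ..
      qed
      moreover have "0 \<le> \<psi>1 (s - c) * norm d" "0 \<le> \<psi>2 (s - c) * norm d" using pos by auto
      ultimately show "1 \<le> (\<psi>1 (s - c) + \<psi>2 (s - c)) * norm d"
        unfolding distrib_right by linarith
    qed
    moreover have "min \<rho>1 \<rho>2 > 0" "\<nu> > 0" using 1 2 by (auto simp: \<nu>_def)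
    ultimately show ?case unfolding Q_def using desing_pair_add[OF pair] by blast
  next
    case (local \<gamma>)
    obtain \<rho> \<nu> \<phi> \<psi> where *: "\<rho> > 0" "\<nu> > 0" "desing_pair \<nu> \<phi> \<psi>"
      "uniform_KL h w c (\<gamma> - \<rho>) (\<gamma> + \<rho>) \<rho> \<nu> \<psi>"
      using KL_at_uniform KL const local by metis
    have "Q \<alpha> \<beta>" if "\<alpha> \<le> \<gamma>" "\<gamma> \<le> \<beta>" "\<beta> - \<alpha> < \<rho>" for \<alpha> \<beta>
    proof -
      have "{\<alpha>..\<beta>} \<subseteq> {\<gamma> - \<rho>..\<gamma> + \<rho>}" using that by auto
      then have "uniform_KL h w c \<alpha> \<beta> \<rho> \<nu> \<psi>"
        using *(4) unfolding uniform_KL_def by blast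
      then show ?thesis using * unfolding Q_def by blast
    qed
    with \<open>\<rho> > 0\<close> show ?case by blast
  qed
  with that show thesis unfolding Q_def by blast
qed

section \<open>Convergence from the KL inequality\<close>

text \<open>\<open>W\<close> bounds the length still to be travelled, but the step estimate holds
  only near \<open>l\<close>. Starting at an index where the sequence is close to \<open>l\<close>
  and \<open>W\<close> is small, the travelled length is too short to leave the ball, so the
  estimate stays available.\<close>

lemma finite_length_convergence:
  fixes X :: "nat \<Rightarrow> 'a::metric_space"
  assumes "\<rho> > 0" and W: "\<forall>\<^sub>F k in sequentially. 0 \<le> W k" "W \<longlonglongrightarrow> 0"
    and step: "\<forall>\<^sub>F k in sequentially. dist (X k) l < \<rho> \<longrightarrow> dist (X (Suc k)) (X k) \<le> W k - W (Suc k)"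
    and acc: "strict_mono r" "(X \<circ> r) \<longlonglongrightarrow> l"
  shows "X \<longlonglongrightarrow> l"
proof (rule metric_LIMSEQ_I)
  fix e :: real assume "e > 0"
  \<comment> \<open>At most \<open>\<rho>\<close>, so staying within \<open>e'\<close> keeps the
    step estimate applicable.\<close>
  define e' where "e' = min e \<rho>"
  have "e' > 0" using \<open>e > 0\<close> \<open>\<rho> > 0\<close> by (simp add: e'_def)
  obtain K where K: "\<And>k. k \<ge> K \<Longrightarrow> dist (X k) l < \<rho> \<Longrightarrow> dist (X (Suc k)) (X k) \<le> W k - W (Suc k)"
    and nonneg: "\<And>k. k \<ge> K \<Longrightarrow> 0 \<le> W k"
    using eventually_conj[OF step W(1)] unfolding eventually_sequentially by blast
  have "\<forall>\<^sub>F j in sequentially. dist ((X \<circ> r) j) l < e' / 2"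
    using tendstoD[OF acc(2)] \<open>e' > 0\<close> half_gt_zero by blast
  moreover have "\<forall>\<^sub>F j in sequentially. dist (W (r j)) 0 < e' / 2"
    using \<open>W \<longlonglongrightarrow> 0\<close> acc(1) \<open>e' > 0\<close> LIMSEQ_subseq_LIMSEQ[of W 0 r] by (intro tendstoD) (auto simp: comp_def)
  moreover have "\<forall>\<^sub>F j in sequentially. r j \<ge> K"
    using acc(1) by (meson eventually_sequentially seq_suble le_trans)
  ultimately have "\<forall>\<^sub>F j in sequentially. dist (X (r j)) l < e' / 2 \<and> W (r j) < e' / 2 \<and> r j \<ge> K"
    by eventually_elim auto
  then obtain j where j: "dist (X (r j)) l < e' / 2" "W (r j) < e' / 2" "r j \<ge> K"
    using eventually_happens'[OF sequentially_bot] by blast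
  have "dist (X n) l < e'" if "n \<ge> r j" for n
  proof -
    \<comment> \<open>With this, the telescoped induction hypothesis places \<open>X n\<close> in
      the ball, which the next step requires.\<close>
    have bound: "dist (X (r j)) l + W (r j) - W n < e'" if "n \<ge> r j" for n
      using j nonneg[of n] that by linarith
    have "dist (X n) l \<le> dist (X (r j)) l + W (r j) - W n"
      using that
    proof (induction n rule: dec_induct)
      case (step n)
      then have "dist (X n) l < \<rho>" using bound[of n] step.hyps by (simp add: e'_def)
      then have "dist (X (Suc n)) (X n) \<le> W n - W (Suc n)"
        using K j(3) step.hyps by auto
      with step.IH show ?case
        using dist_triangle[of "X (Suc n)" l "X n"] by linarith
    qed simp
    with bound[OF that] show ?thesis by linarith
  qed
  then show "\<exists>n0. \<forall>n\<ge>n0. dist (X n) l < e" by (auto simp: e'_def)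
qed

text \<open>In the application \<open>a\<close>, \<open>b\<close>, \<open>c\<close> are the excesses
  of three consecutive reference values over their limit, \<open>s\<close> is that of the potential,
  \<open>d\<close> is a step length and \<open>D\<close> the sum of the two before it.
  \<open>\<Theta>\<close> adds the terms of the two cases, so that both telescope in the same
  monotone sequence.\<close>

lemma line_search_combination:
  fixes \<phi> \<psi> :: "real \<Rightarrow> real"
  assumes pair: "desing_pair \<nu> \<phi> \<psi>" and pos: "0 < \<kappa>" "0 < C" "0 < q" "q < 1"
    and ord: "0 \<le> c" "c \<le> b" "b \<le> a" "a < \<nu>" "s \<le> b" and drop: "q * (a - s) \<le> a - b"
    and d: "0 \<le> d" "0 \<le> D" "\<kappa> * d\<^sup>2 \<le> b - c"
    and KL: "0 < s \<Longrightarrow> 1 \<le> \<psi> s * (C * D)"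
    and \<Theta>: "\<And>t. \<Theta> t = sqrt t / ((1 - sqrt (1 - q / 2)) * sqrt \<kappa>) + 2 * C / \<kappa> * \<phi> (t / 2)"
  shows "d \<le> D / 4 + (\<Theta> a - \<Theta> c)"
proof -
  define l where "l = sqrt (1 - q / 2)"
  have l: "0 \<le> l" "l < 1" using pos by (auto simp: l_def)
  have den: "0 < (1 - l) * sqrt \<kappa>" using l pos by simp
  have sq: "sqrt c \<le> sqrt b" "sqrt b \<le> sqrt a" using ord by auto
  have ph: "\<phi> (c / 2) \<le> \<phi> (b / 2)" "\<phi> (b / 2) \<le> \<phi> (a / 2)"
    using ord by (auto intro!: desing_pair_mono_fun[OF pair])
  have \<Theta>_diff: "\<Theta> a - \<Theta> c = (sqrt a - sqrt c) / ((1 - l) * sqrt \<kappa>) + 2 * C / \<kappa> * (\<phi> (a / 2) - \<phi> (c / 2))"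
    unfolding \<Theta> l_def by (simp add: diff_divide_distrib right_diff_distrib)
  have part1: "0 \<le> (sqrt a - sqrt c) / ((1 - l) * sqrt \<kappa>)"
    using den sq by (intro divide_nonneg_pos) auto
  have part2: "2 * C / \<kappa> * (\<phi> (b / 2) - \<phi> (c / 2)) \<le> 2 * C / \<kappa> * (\<phi> (a / 2) - \<phi> (c / 2))"
    "0 \<le> 2 * C / \<kappa> * (\<phi> (b / 2) - \<phi> (c / 2))"
    using ph pos by (intro mult_left_mono mult_nonneg_nonneg divide_nonneg_pos; simp)+
  show ?thesis
  proof (cases "s \<le> a / 2")
    case True
    \<comment> \<open>Here \<open>a - s\<close> is at least \<open>a / 2\<close>, so
      \<open>drop\<close> makes \<open>b\<close> smaller than \<open>a\<close> by the factor
      \<open>1 - q / 2\<close>.\<close>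
    have "q * (a / 2) \<le> q * (a - s)" using True pos by (intro mult_left_mono) auto
    with drop have "b \<le> (1 - q / 2) * a" by (simp add: algebra_simps)
    then have "sqrt b \<le> l * sqrt a" unfolding l_def by (metis real_sqrt_le_iff real_sqrt_mult)
    then have "(1 - l) * sqrt a \<le> sqrt a - sqrt b" by (simp add: algebra_simps)
    also have "\<dots> \<le> sqrt a - sqrt c" using sq by simp
    finally have 1: "(1 - l) * sqrt a \<le> sqrt a - sqrt c" .
    have "sqrt (\<kappa> * d\<^sup>2) \<le> sqrt a" using d(3) ord by (intro real_sqrt_le_mono) linarith
    then have "sqrt \<kappa> * d \<le> sqrt a" using d by (simp add: real_sqrt_mult)
    then have "(1 - l) * (sqrt \<kappa> * d) \<le> (1 - l) * sqrt a" using l by (intro mult_left_mono) auto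
    with 1 have "d * ((1 - l) * sqrt \<kappa>) \<le> sqrt a - sqrt c" by (simp add: mult_ac)
    then have "d \<le> (sqrt a - sqrt c) / ((1 - l) * sqrt \<kappa>)" using den by (simp add: pos_le_divide_eq)
    with \<Theta>_diff part2 d(2) show ?thesis by linarith
  next
    case False
    then have s: "0 < s" "0 < b" using ord by linarith+
    have "1 \<le> \<psi> s * (C * D)" using KL s by simp
    \<comment> \<open>Since \<open>s > a / 2\<close> and \<open>b \<le> a\<close>, monotonicity
      replaces \<open>s\<close> by \<open>b / 2\<close>. The KL bound then refers to reference
      values, which decrease, and no longer to the potential, which may oscillate.\<close>
    also have "\<dots> \<le> \<psi> (b / 2) * (C * D)"
      using pos d(2) False ord s by (intro mult_right_mono desing_pair_antimono[OF pair]) auto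
    finally have psi: "1 \<le> \<psi> (b / 2) * (C * D)" .
    have "\<psi> (b / 2) * (b / 2 - c / 2) \<le> \<phi> (b / 2) - \<phi> (c / 2)"
      using pair s ord unfolding desing_pair_def by auto
    then have "C * D * (\<psi> (b / 2) * (b / 2 - c / 2)) \<le> C * D * (\<phi> (b / 2) - \<phi> (c / 2))"
      using pos d(2) by (intro mult_left_mono) auto
    moreover have "1 * (b / 2 - c / 2) \<le> (\<psi> (b / 2) * (C * D)) * (b / 2 - c / 2)"
      using psi ord by (intro mult_right_mono) auto
    moreover have "(\<psi> (b / 2) * (C * D)) * (b / 2 - c / 2) = C * D * (\<psi> (b / 2) * (b / 2 - c / 2))"
      by (simp only: mult_ac)
    ultimately have "1 * (b / 2 - c / 2) \<le> C * D * (\<phi> (b / 2) - \<phi> (c / 2))" by linarith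
    then have "2 * (1 * (b / 2 - c / 2)) \<le> 2 * (C * D * (\<phi> (b / 2) - \<phi> (c / 2)))"
      by (rule mult_left_mono) simp
    moreover have "b - c = 2 * (1 * (b / 2 - c / 2))" by simp
    ultimately have "b - c \<le> 2 * C * D * (\<phi> (b / 2) - \<phi> (c / 2))" by (simp only: mult.assoc)
    then have "\<kappa> * d\<^sup>2 \<le> 2 * C * D * (\<phi> (b / 2) - \<phi> (c / 2))" using d(3) by linarith
    then have "d\<^sup>2 * \<kappa> \<le> 2 * C * D * (\<phi> (b / 2) - \<phi> (c / 2))" by (simp only: mult.commute)
    then have "d\<^sup>2 \<le> 2 * C * D * (\<phi> (b / 2) - \<phi> (c / 2)) / \<kappa>" by (simp only: pos_le_divide_eq[OF pos(1)])
    define M where "M = 2 * C / \<kappa> * (\<phi> (b / 2) - \<phi> (c / 2))"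
    have "d\<^sup>2 \<le> D * M" using \<open>d\<^sup>2 \<le> _\<close> unfolding M_def by (simp only: times_divide_eq_left times_divide_eq_right mult_ac)
    \<comment> \<open>The difference of the two sides is \<open>(D / 4 - M)\<^sup>2\<close>; this is
      where the quarter comes from.\<close>
    also have "D * M \<le> (D / 4 + M)\<^sup>2"
      using zero_le_power2[of "D / 4 - M"] by (simp add: power2_eq_square algebra_simps)
    finally have "d\<^sup>2 \<le> (D / 4 + M)\<^sup>2" .
    moreover have "0 \<le> M" "M \<le> 2 * C / \<kappa> * (\<phi> (a / 2) - \<phi> (c / 2))"
      using part2 unfolding M_def by blast+
    ultimately have "d \<le> D / 4 + M" using d(2) power2_le_imp_le by (metis add_nonneg_nonneg divide_nonneg_nonneg zero_le_numeral)
    also have "\<dots> \<le> D / 4 + (\<Theta> a - \<Theta> c)"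
      unfolding \<Theta>_diff using part1 \<open>M \<le> _\<close> by (intro add_left_mono) simp
    finally show ?thesis .
  qed
qed

section \<open>Estimates for the problem data\<close>

text \<open>A descent lemma with the gradient taken at a third point \<open>y\<close>, the
  extrapolated one. The mean value point lies on the segment from \<open>x\<close> to
  \<open>z\<close>, hence in the ball, and its distance to \<open>y\<close> is at most
  \<open>norm (z - x) + norm (x - y)\<close>.\<close>

lemma gradient_lipschitz_ascent:
  fixes f :: "'a::euclidean_space \<Rightarrow> real"
  assumes "\<And>z. GDERIV f z :> g z" "L-lipschitz_on (ball w \<rho>) g"
    and xyz: "x \<in> ball w \<rho>" "y \<in> ball w \<rho>" "z \<in> ball w \<rho>"
  shows "f z - f x \<le> g y \<bullet> (z - x) + L * (norm (z - x))\<^sup>2 + L * norm (x - y) * norm (z - x)"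
proof -
  have "\<exists>t>0. t < 1 \<and> f (x + 1 *\<^sub>R (z - x)) - f (x + 0 *\<^sub>R (z - x)) = (1 - 0) * (g (x + t *\<^sub>R (z - x)) \<bullet> (z - x))"
  proof (rule MVT2)
    fix t :: real
    have "(f has_derivative (\<lambda>h. g (x + t *\<^sub>R (z - x)) \<bullet> h)) (at (x + t *\<^sub>R (z - x)))"
      using assms(1)[of "x + t *\<^sub>R (z - x)"] by (simp add: gderiv_def inner_commute)
    moreover have "((\<lambda>t. x + t *\<^sub>R (z - x)) has_derivative (\<lambda>h. h *\<^sub>R (z - x))) (at t)"
      by (auto intro!: derivative_eq_intros)
    ultimately have "((\<lambda>t. f (x + t *\<^sub>R (z - x))) has_derivative (\<lambda>h. g (x + t *\<^sub>R (z - x)) \<bullet> (h *\<^sub>R (z - x)))) (at t)"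
      using has_derivative_compose by fastforce
    then show "((\<lambda>t. f (x + t *\<^sub>R (z - x))) has_real_derivative g (x + t *\<^sub>R (z - x)) \<bullet> (z - x)) (at t)"
      unfolding has_field_derivative_def by (rule has_derivative_eq_rhs) (simp add: fun_eq_iff mult.commute)
  qed simp
  then obtain t where t: "0 < t" "t < 1" "f z - f x = g (x + t *\<^sub>R (z - x)) \<bullet> (z - x)" by auto
  define u where "u = x + t *\<^sub>R (z - x)"
  have "u = (1 - t) *\<^sub>R x + t *\<^sub>R z" by (simp add: u_def algebra_simps)
  then have "u \<in> ball w \<rho>" using convexD_alt[OF convex_ball xyz(1,3), of t] t by simp
  then have "norm (g u - g y) \<le> L * norm (u - y)"
    using lipschitz_onD[OF assms(2) _ xyz(2)] by (simp add: dist_norm)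
  also have "norm (u - y) \<le> norm (z - x) + norm (x - y)"
  proof -
    have "norm (u - y) \<le> norm (x - y) + norm (t *\<^sub>R (z - x))"
      using norm_triangle_ineq[of "x - y" "t *\<^sub>R (z - x)"] by (simp add: u_def algebra_simps)
    moreover have "norm (t *\<^sub>R (z - x)) \<le> norm (z - x)"
      using t mult_left_le_one_le[of "norm (z - x)" t] by simp
    ultimately show ?thesis by linarith
  qed
  finally have gl: "norm (g u - g y) \<le> L * (norm (z - x) + norm (x - y))"
    using lipschitz_on_nonneg[OF assms(2)] by (simp add: mult_left_mono)
  have "g u \<bullet> (z - x) = g y \<bullet> (z - x) + (g u - g y) \<bullet> (z - x)" by (simp add: inner_diff_left)
  also have "\<dots> \<le> g y \<bullet> (z - x) + norm (g u - g y) * norm (z - x)"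
    using norm_cauchy_schwarz by auto
  also have "\<dots> \<le> g y \<bullet> (z - x) + L * (norm (z - x) + norm (x - y)) * norm (z - x)"
    using gl by (auto intro: mult_right_mono)
  finally show ?thesis using t(3) by (simp add: u_def power2_eq_square algebra_simps)
qed

text \<open>Testing the subgradient inequality at \<open>x + sgn \<xi>\<close> isolates
  \<open>norm \<xi>\<close>. The ball of radius 2 contains all test points, and \<open>h\<close> is
  bounded on it.\<close>

lemma subgradient_bounded:
  fixes h :: "'a::euclidean_space \<Rightarrow> real"
  assumes "convex_on UNIV h"
  obtains M where "\<And>x \<xi>. dist x w \<le> 1 \<Longrightarrow> (\<And>z. h x + \<xi> \<bullet> (z - x) \<le> h z) \<Longrightarrow> norm \<xi> \<le> M"
proof -
  have "continuous_on (cball w 2) h"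
    using convex_on_continuous[OF open_UNIV assms] continuous_on_subset by blast
  then have "bounded (h ` cball w 2)"
    by (intro compact_imp_bounded compact_continuous_image) auto
  then obtain M where "\<forall>t\<in>h ` cball w 2. \<bar>t\<bar> \<le> M"
    unfolding bounded_real by (rule exE)
  then have M: "\<bar>h z\<bar> \<le> M" if "z \<in> cball w 2" for z
    using that by (rule bspec[OF _ imageI])
  have "norm \<xi> \<le> 2 * M" if x: "dist x w \<le> 1" "\<And>z. h x + \<xi> \<bullet> (z - x) \<le> h z" for x \<xi>
  proof -
    have "dist (x + sgn \<xi>) w \<le> dist x w + norm (sgn \<xi>)"
      using dist_triangle[of "x + sgn \<xi>" w x] by (simp add: dist_norm)
    also have "\<dots> \<le> 2" using x(1) by (simp add: norm_sgn)
    finally have "\<bar>h (x + sgn \<xi>)\<bar> \<le> M" "\<bar>h x\<bar> \<le> M" using x(1) by (auto intro!: M simp: dist_commute)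
    moreover have "\<xi> \<bullet> sgn \<xi> = norm \<xi>"
      by (cases "\<xi> = 0") (auto simp: sgn_div_norm power2_norm_eq_inner[symmetric] power2_eq_square)
    ultimately show ?thesis using x(2)[of "x + sgn \<xi>"] by simp
  qed
  then show thesis by (rule that)
qed

lemma potential_eq:
  "potential f P1 P2 \<delta> (u, w, \<gamma>) = P1 u + ereal (f u - P2 u + \<delta> * \<gamma> / 8 * (norm (u - w))\<^sup>2)"
  by (cases "P1 u") (auto simp: potential_def objective_def)

text \<open>The potential is \<open>P1\<close> of the first variable plus a smooth function of all
  three. The last component is the derivative with respect to the step size.\<close>

lemma potential_frechet:
  assumes "v \<in> frechet_subdiff P1 u" "GDERIV f u :> a" "GDERIV P2 u :> b"
  shows "(v + (a - b + (\<delta> * \<gamma> / 4) *\<^sub>R (u - w)), - ((\<delta> * \<gamma> / 4) *\<^sub>R (u - w)), \<delta> / 8 * (norm (u - w))\<^sup>2)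
    \<in> frechet_subdiff (potential f P1 P2 \<delta>) (u, w, \<gamma>)"
proof -
  define G where "G = (a - b + (\<delta> * \<gamma> / 4) *\<^sub>R (u - w), - ((\<delta> * \<gamma> / 4) *\<^sub>R (u - w)), \<delta> / 8 * (norm (u - w))\<^sup>2)"
  \<comment> \<open>The squared norm is written as an inner product so that the derivative rules
    apply.\<close>
  define s where "s = (\<lambda>z. f (fst z) - P2 (fst z) + \<delta> * snd (snd z) / 8 * ((fst z - fst (snd z)) \<bullet> (fst z - fst (snd z))))"
  have "(f has_derivative (\<lambda>h. a \<bullet> h)) (at (fst (u, w, \<gamma>)))" "(P2 has_derivative (\<lambda>h. b \<bullet> h)) (at (fst (u, w, \<gamma>)))"
    using assms(2,3) by (simp_all add: gderiv_def inner_commute)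
  from this[THEN has_derivative_compose[OF has_derivative_fst[OF has_derivative_ident], rotated]]
  have "(s has_derivative (\<lambda>h. a \<bullet> fst h - b \<bullet> fst h +
      (\<delta> * \<gamma> / 8 * ((u - w) \<bullet> (fst h - fst (snd h)) + (fst h - fst (snd h)) \<bullet> (u - w)) +
       \<delta> * snd (snd h) / 8 * ((u - w) \<bullet> (u - w))))) (at (u, w, \<gamma>))"
    unfolding s_def by (auto intro!: derivative_eq_intros)
  then have "(s has_derivative (\<lambda>h. G \<bullet> h)) (at (u, w, \<gamma>))"
    by (rule has_derivative_eq_rhs)
       (auto simp: G_def fun_eq_iff inner_diff_left inner_diff_right inner_add_left inner_commute
         power2_norm_eq_inner algebra_simps add_divide_distrib diff_divide_distrib)
  from frechet_subdiff_add_smooth[OF frechet_subdiff_fst[OF assms(1), of "(w, \<gamma>)"] this]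
  have "(v, 0) + G \<in> frechet_subdiff (\<lambda>z. P1 (fst z) + ereal (s z)) (u, w, \<gamma>)" .
  moreover have "(\<lambda>z. P1 (fst z) + ereal (s z)) = potential f P1 P2 \<delta>"
    by (auto simp: fun_eq_iff potential_eq s_def power2_norm_eq_inner)
  ultimately show ?thesis by (simp add: G_def zero_prod_def)
qed

text \<open>The KL assumption covers only points of the subdifferential domain. The sequences
  witnessing a limiting subgradient of \<open>P1\<close> at \<open>w\<close> are lifted, with the
  other two variables fixed at \<open>w\<close> and \<open>\<gamma>\<close>.\<close>

lemma stationary_in_dom_subdiff_potential:
  assumes "stationary_point f g P1 P2 w" "open N" "w \<in> N" "C1_with_gradient_on UNIV f g"
    "C1_with_gradient_on N P2 gP2"
  shows "(w, w, \<gamma>) \<in> dom_subdiff (potential f P1 P2 \<delta>)"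
proof -
  obtain a X D where a: "\<bar>P1 w\<bar> \<noteq> \<infinity>" "X \<longlonglongrightarrow> w" "(\<lambda>k. P1 (X k)) \<longlonglongrightarrow> P1 w" "D \<longlonglongrightarrow> a"
    "\<And>k. D k \<in> frechet_subdiff P1 (X k)"
    using assms(1) unfolding stationary_point_def limiting_subdiff_def by auto
  obtain K where K: "\<And>k. k \<ge> K \<Longrightarrow> X k \<in> N"
    using topological_tendstoD[OF a(2) assms(2,3)] unfolding eventually_sequentially by blast
  \<comment> \<open>The tail on which all points lie in \<open>N\<close>: the limiting
    subdifferential demands a Frechet subgradient for every index.\<close>
  define Y E where "Y k = X (k + K)" and "E k = D (k + K)" for k
  have Y: "Y \<longlonglongrightarrow> w" "(\<lambda>k. P1 (Y k)) \<longlonglongrightarrow> P1 w" "E \<longlonglongrightarrow> a"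
    unfolding Y_def [abs_def] E_def [abs_def] by (intro LIMSEQ_ignore_initial_segment a)+
  have YN: "\<And>k. E k \<in> frechet_subdiff P1 (Y k)" "\<And>k. Y k \<in> N"
    using a K by (auto simp: Y_def E_def)
  have g: "GDERIV f z :> g z" for z using assms(4) by (auto simp: C1_with_gradient_on_def)
  have gP2: "GDERIV P2 z :> gP2 z" if "z \<in> N" for z using assms(5) that by (auto simp: C1_with_gradient_on_def)
  have "isCont g w" "isCont gP2 w"
    using assms(2-5) continuous_on_eq_continuous_at by (auto simp: C1_with_gradient_on_def)
  moreover have "isCont f w" "isCont P2 w"
    using has_derivative_continuous[OF g[of w, unfolded gderiv_def]]
      has_derivative_continuous[OF gP2[OF assms(3), unfolded gderiv_def]] by simp_all
  ultimately have "isCont g w" "isCont gP2 w" "isCont f w" "isCont P2 w" by auto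
  note lim = this[THEN isCont_tendsto_compose, OF Y(1)]
  define V where "V k = (E k + (g (Y k) - gP2 (Y k) + (\<delta> * \<gamma> / 4) *\<^sub>R (Y k - w)), - ((\<delta> * \<gamma> / 4) *\<^sub>R (Y k - w)), \<delta> / 8 * (norm (Y k - w))\<^sup>2)" for k
  have V1: "V k \<in> frechet_subdiff (potential f P1 P2 \<delta>) (Y k, w, \<gamma>)" for k
    unfolding V_def by (intro potential_frechet YN g gP2)
  have V2: "V \<longlonglongrightarrow> (a + (g w - gP2 w + (\<delta> * \<gamma> / 4) *\<^sub>R (w - w)), - ((\<delta> * \<gamma> / 4) *\<^sub>R (w - w)), \<delta> / 8 * (norm (w - w))\<^sup>2)"
    unfolding V_def by (intro tendsto_intros Y lim)
  have V3: "(\<lambda>k. (Y k, w, \<gamma>)) \<longlonglongrightarrow> (w, w, \<gamma>)" by (intro tendsto_intros Y)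
  have V4: "(\<lambda>k. potential f P1 P2 \<delta> (Y k, w, \<gamma>)) \<longlonglongrightarrow> potential f P1 P2 \<delta> (w, w, \<gamma>)"
    unfolding potential_eq using a(1) by (intro tendsto_add_ereal Y tendsto_ereal tendsto_intros lim) auto
  have V5: "\<bar>potential f P1 P2 \<delta> (w, w, \<gamma>)\<bar> \<noteq> \<infinity>"
    unfolding potential_eq using a(1) by auto
  have "(a + (g w - gP2 w + (\<delta> * \<gamma> / 4) *\<^sub>R (w - w)), - ((\<delta> * \<gamma> / 4) *\<^sub>R (w - w)), \<delta> / 8 * (norm (w - w))\<^sup>2)
      \<in> limiting_subdiff (potential f P1 P2 \<delta>) (w, w, \<gamma>)"
    unfolding limiting_subdiff_def mem_Collect_eq
    using V1 V2 V3 V4 V5 by (intro conjI exI[of _ "\<lambda>k. (Y k, w, \<gamma>)"] exI[of _ V] allI)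
  then show ?thesis unfolding dom_subdiff_def by blast
qed

section \<open>Runs of nexPGA\<close>

locale nexPGA =
  fixes f P2 :: "'a::euclidean_space \<Rightarrow> real" and P1 :: "'a \<Rightarrow> ereal" and g gP2 :: "'a \<Rightarrow> 'a" and N :: "'a set"
    and \<gamma>min \<gamma>max \<beta>max pmin \<delta> \<tau> \<eta> :: real
    and x \<xi> :: "nat \<Rightarrow> 'a" and \<beta>0 \<gamma>0 :: "nat \<Rightarrow> real" and trial :: "nat \<Rightarrow> nat \<Rightarrow> 'a"
    and acc :: "nat \<Rightarrow> nat" and p :: "nat \<Rightarrow> real" and R :: "nat \<Rightarrow> ereal"
    and xs :: 'a and r :: "nat \<Rightarrow> nat"
  assumes f_C1: "C1_with_gradient_on UNIV f g"
    and f_lip: "locally_lipschitz_on UNIV g"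
    and P1_proper: "proper_fun P1"
    and P1_closed: "lsc P1"
    and P1_prox_bounded: "prox_bounded P1"
    and P2_convex: "convex_on UNIV P2"
    and F_bounded_below: "\<exists>m::real. \<forall>z \<in> effdom P1. ereal m \<le> objective f P1 P2 z"
    and N_open: "open N"
    and N_stationary: "{z. stationary_point f g P1 P2 z} \<subseteq> N"
    and P2_C1: "C1_with_gradient_on N P2 gP2"
    and P2_lip: "locally_lipschitz_on N gP2"
    and gamma: "0 < \<gamma>min" "\<gamma>min \<le> \<gamma>max"
    and beta: "0 \<le> \<beta>max"
    and pmin: "0 < pmin" "pmin < 1"
    and delta: "0 \<le> \<delta>" "\<delta> < 1"
    and tau: "1 < \<tau>"
    and eta: "0 < \<eta>" "\<eta> < 1 / sqrt \<tau>"
    and run: "nexPGA_run f g P1 P2 \<gamma>min \<gamma>max \<beta>max pmin \<delta> \<tau> \<eta> x \<xi> \<beta>0 \<gamma>0 trial acc p R"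
    and r: "strict_mono r" "(x \<circ> r) \<longlonglongrightarrow> xs"
begin

definition p1 :: "'a \<Rightarrow> real" where "p1 z = real_of_ereal (P1 z)"
definition F :: "'a \<Rightarrow> real" where "F z = f z + p1 z - P2 z"
definition \<gamma> :: "nat \<Rightarrow> real" where "\<gamma> k = \<tau> ^ acc k * \<gamma>0 k"
definition y :: "nat \<Rightarrow> 'a" where "y k = x k + (\<eta> ^ acc k * \<beta>0 k) *\<^sub>R (x k - x (k - 1))"
definition d :: "nat \<Rightarrow> real" where "d k = norm (x (Suc k) - x k)"
text \<open>The length of the previous step; truncated subtraction makes it 0 at
  \<open>k = 0\<close>.\<close>

definition e :: "nat \<Rightarrow> real" where "e k = norm (x k - x (k - 1))"
definition R' :: "nat \<Rightarrow> real" where "R' k = real_of_ereal (R k)"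
definition h :: "nat \<Rightarrow> real" where "h k = F (x (Suc k)) + \<delta> * \<gamma> k / 8 * (d k)\<^sup>2"

abbreviation prox :: "'a \<Rightarrow> 'a \<Rightarrow> real \<Rightarrow> 'a \<Rightarrow> bool"
  where "prox \<zeta> u c \<equiv> is_arg_min (nexPGA_model g P1 \<zeta> u c) (\<lambda>_. True)"

section \<open>Regularity of the data and unpacking of the run\<close>

lemma g_gradient: "GDERIV f z :> g z"
  using f_C1 by (simp add: C1_with_gradient_on_def)

lemma gP2_gradient: "z \<in> N \<Longrightarrow> GDERIV P2 z :> gP2 z"
  using P2_C1 by (simp add: C1_with_gradient_on_def)

lemma cont_g: "continuous_on UNIV g"
  using f_C1 by (simp add: C1_with_gradient_on_def)

lemma cont_f: "continuous_on UNIV f"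
  using g_gradient unfolding gderiv_def
  by (intro continuous_at_imp_continuous_on ballI has_derivative_continuous)

lemma cont_P2: "continuous_on UNIV P2"
  by (intro convex_on_continuous P2_convex) auto

lemma tendsto_f: "X \<longlonglongrightarrow> w \<Longrightarrow> (\<lambda>n. f (X n)) \<longlonglongrightarrow> f w"
  and tendsto_g: "X \<longlonglongrightarrow> w \<Longrightarrow> (\<lambda>n. g (X n)) \<longlonglongrightarrow> g w"
  and tendsto_P2: "X \<longlonglongrightarrow> w \<Longrightarrow> (\<lambda>n. P2 (X n)) \<longlonglongrightarrow> P2 w"
  using cont_f cont_g cont_P2
  by (auto simp: continuous_on_eq_continuous_at intro: isCont_tendsto_compose)

lemma P1_eq: "z \<in> effdom P1 \<Longrightarrow> P1 z = ereal (p1 z)"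
  using P1_proper by (cases "P1 z") (auto simp: p1_def effdom_def proper_fun_def)

lemma objective_eq: "z \<in> effdom P1 \<Longrightarrow> objective f P1 P2 z = ereal (F z)"
  by (simp add: objective_def P1_eq F_def)

lemma potential_real:
  "z \<in> effdom P1 \<Longrightarrow> potential f P1 P2 \<delta> (z, w, c) = ereal (F z + \<delta> * c / 8 * (norm (z - w))\<^sup>2)"
  by (simp add: potential_eq P1_eq F_def)

text \<open>The term \<open>\<delta> * c / 8\<close> of the potential and the required decrease
  \<open>(1 - \<delta>) * c / 8\<close> add up to \<open>c / 8\<close>.\<close>

lemma line_search_real:
  "z \<in> effdom P1 \<Longrightarrow> line_search_ok f P1 P2 \<delta> (ereal a) w c z \<longleftrightarrow> F z + c / 8 * (norm (z - w))\<^sup>2 \<le> a"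
  by (auto simp: line_search_ok_def potential_real field_simps)

lemma prox_dom: "prox \<zeta> u c z \<Longrightarrow> z \<in> effdom P1"
proof -
  assume "prox \<zeta> u c z"
  moreover obtain z0 where "z0 \<in> effdom P1" using P1_proper by (auto simp: proper_fun_def)
  ultimately have "\<not> nexPGA_model g P1 \<zeta> u c z0 < nexPGA_model g P1 \<zeta> u c z" "P1 z0 < \<infinity>"
    by (auto simp: is_arg_min_def effdom_def)
  then show ?thesis
    by (cases "P1 z"; cases "P1 z0") (auto simp: nexPGA_model_def effdom_def)
qed

lemma prox_le:
  assumes "prox \<zeta> u c z" "w \<in> effdom P1"
  shows "(g u - \<zeta>) \<bullet> (z - u) + c / 2 * (norm (z - u))\<^sup>2 + p1 z \<le> (g u - \<zeta>) \<bullet> (w - u) + c / 2 * (norm (w - u))\<^sup>2 + p1 w"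
proof -
  have "nexPGA_model g P1 \<zeta> u c z \<le> nexPGA_model g P1 \<zeta> u c w"
    using assms(1) by (auto simp: is_arg_min_def not_less)
  then show ?thesis
    using P1_eq[OF prox_dom[OF assms(1)]] P1_eq[OF assms(2)] by (simp add: nexPGA_model_def)
qed

lemma run_step:
  shows \<xi>: "\<xi> k \<in> limiting_subdiff (\<lambda>z. ereal (P2 z)) (x k)"
    and \<beta>0: "\<beta>0 k \<in> {0..\<delta> * \<beta>max}"
    and \<gamma>0: "\<gamma>0 k \<in> {\<gamma>min..\<gamma>max}"
    and acc: "i < acc k \<Longrightarrow>
      (\<nexists>z. prox (\<xi> k) (x k + (\<eta> ^ i * \<beta>0 k) *\<^sub>R (x k - x (k - 1))) (\<tau> ^ i * \<gamma>0 k) z) \<or>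
      prox (\<xi> k) (x k + (\<eta> ^ i * \<beta>0 k) *\<^sub>R (x k - x (k - 1))) (\<tau> ^ i * \<gamma>0 k) (trial k i) \<and>
      \<not> line_search_ok f P1 P2 \<delta> (R k) (x k) (\<tau> ^ i * \<gamma>0 k) (trial k i)"
    and x_prox: "prox (\<xi> k) (y k) (\<gamma> k) (x (Suc k))"
    and x_ok: "line_search_ok f P1 P2 \<delta> (R k) (x k) (\<gamma> k) (x (Suc k))"
    and p: "p (Suc k) \<in> {pmin..1}"
    and R_Suc: "R (Suc k) = ereal (1 - p (Suc k)) * R k + ereal (p (Suc k)) * potential f P1 P2 \<delta> (x (Suc k), x k, \<gamma> k)"
  using run unfolding nexPGA_run_def Let_def y_def \<gamma>_def by auto

lemma x_dom: "x k \<in> effdom P1"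
proof (cases k)
  case 0
  then show ?thesis using run by (simp add: nexPGA_run_def)
next
  case (Suc j)
  then show ?thesis using prox_dom[OF x_prox, of j] by simp
qed

lemma h_eq: "potential f P1 P2 \<delta> (x (Suc k), x k, \<gamma> k) = ereal (h k)"
  by (simp add: potential_real x_dom h_def d_def)

lemma R_eq: "R k = ereal (R' k)"
proof (induction k)
  case 0
  have "R 0 = objective f P1 P2 (x 0)" using run by (simp add: nexPGA_run_def)
  then show ?case by (simp add: R'_def objective_eq x_dom)
next
  case (Suc k)
  have "\<bar>R (Suc k)\<bar> \<noteq> \<infinity>" unfolding R_Suc h_eq Suc by simp
  then show ?case by (auto simp: R'_def)
qed

lemma R'_0: "R' 0 = F (x 0)"
  using run by (simp add: nexPGA_run_def R'_def objective_eq x_dom)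

lemma R'_Suc: "R' (Suc k) = (1 - p (Suc k)) * R' k + p (Suc k) * h k"
proof -
  have "ereal (R' (Suc k)) = ereal (1 - p (Suc k)) * ereal (R' k) + ereal (p (Suc k)) * ereal (h k)"
    unfolding R_eq[symmetric] h_eq[symmetric] by (rule R_Suc)
  then show ?thesis by simp
qed

lemma \<xi>_subgradient: "P2 (x k) + \<xi> k \<bullet> (z - x k) \<le> P2 z"
  using \<xi> limiting_subdiff_convex_iff[OF P2_convex] by blast

lemma \<gamma>_ge: "\<gamma>min \<le> \<gamma> k"
proof -
  have "1 * \<gamma>min \<le> \<tau> ^ acc k * \<gamma>0 k"
    using \<gamma>0[of k] tau gamma by (intro mult_mono) auto
  then show ?thesis by (simp add: \<gamma>_def)
qed

section \<open>Decrease of the reference values\<close>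

lemma F_sufficient_decrease: "F (x (Suc k)) + \<gamma> k / 8 * (d k)\<^sup>2 \<le> R' k"
  using x_ok[of k] by (simp add: R_eq line_search_real x_dom d_def)

lemma h_decrease: "h k + (1 - \<delta>) * \<gamma> k / 8 * (d k)\<^sup>2 \<le> R' k"
  using F_sufficient_decrease[of k] by (simp add: h_def algebra_simps diff_divide_distrib)

lemma h_le: "h k \<le> R' k"
proof -
  have "0 \<le> (1 - \<delta>) * \<gamma> k / 8 * (d k)\<^sup>2" using \<gamma>_ge[of k] gamma delta by simp
  with h_decrease[of k] show ?thesis by linarith
qed

lemma R'_drop: "pmin * (R' k - h k) \<le> R' k - R' (Suc k)"
proof -
  have "R' k - R' (Suc k) = p (Suc k) * (R' k - h k)" unfolding R'_Suc by (simp add: algebra_simps)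
  moreover have "pmin * (R' k - h k) \<le> p (Suc k) * (R' k - h k)"
    using p[of k] h_le[of k] by (intro mult_right_mono) auto
  ultimately show ?thesis by simp
qed

text \<open>\<open>R' (Suc k)\<close> is a convex combination of \<open>h k\<close> and a number at
  least as large.\<close>

lemma h_le_Suc: "h k \<le> R' (Suc k)"
proof -
  have "0 \<le> (1 - p (Suc k)) * (R' k - h k)" using p[of k] h_le[of k] by simp
  then show ?thesis unfolding R'_Suc by (simp add: algebra_simps)
qed

lemma R'_decseq: "decseq R'"
proof (rule decseq_SucI)
  fix k
  have "0 \<le> pmin * (R' k - h k)" using pmin h_le[of k] by simp
  then show "R' (Suc k) \<le> R' k" using R'_drop[of k] by linarith
qed

lemma F_le_h: "F (x (Suc k)) \<le> h k"
  using \<gamma>_ge[of k] gamma delta by (simp add: h_def)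

lemma F_le_R': "F (x k) \<le> R' k"
proof (cases k)
  case (Suc j)
  then show ?thesis using F_le_h[of j] h_le_Suc[of j] by simp
qed (simp add: R'_0)

definition Rlim :: real where "Rlim = lim R'"

lemma R'_tendsto: "R' \<longlonglongrightarrow> Rlim"
proof -
  obtain m :: real where m: "\<And>z. z \<in> effdom P1 \<Longrightarrow> ereal m \<le> objective f P1 P2 z"
    using F_bounded_below by blast
  have "m \<le> R' k" for k
    using m[OF x_dom, of k] F_le_R'[of k] by (simp add: objective_eq x_dom)
  then have "convergent R'" by (meson R'_decseq decseq_convergent convergentI)
  then show ?thesis by (simp add: Rlim_def convergent_LIMSEQ_iff)
qed

lemma Rlim_le: "Rlim \<le> R' k"
  using decseq_ge[OF R'_decseq R'_tendsto] .

text \<open>The line search gives the factor \<open>(1 - \<delta>) * \<gamma>min / 8\<close>;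
  averaging keeps at least the fraction \<open>pmin\<close> of that decrease.\<close>

definition \<kappa> :: real where "\<kappa> = pmin * ((1 - \<delta>) * \<gamma>min / 8)"

lemma \<kappa>_pos: "0 < \<kappa>" using pmin delta gamma by (simp add: \<kappa>_def)

lemma R'_square_decrease: "\<kappa> * (d k)\<^sup>2 \<le> R' k - R' (Suc k)"
proof -
  have "(1 - \<delta>) * \<gamma>min / 8 * (d k)\<^sup>2 \<le> (1 - \<delta>) * \<gamma> k / 8 * (d k)\<^sup>2"
    using delta \<gamma>_ge[of k] by (intro mult_right_mono divide_right_mono mult_left_mono) auto
  then have "(1 - \<delta>) * \<gamma>min / 8 * (d k)\<^sup>2 \<le> R' k - h k" using h_decrease[of k] by linarith
  then have "pmin * ((1 - \<delta>) * \<gamma>min / 8 * (d k)\<^sup>2) \<le> pmin * (R' k - h k)"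
    using pmin by (intro mult_left_mono) auto
  moreover have "\<kappa> * (d k)\<^sup>2 = pmin * ((1 - \<delta>) * \<gamma>min / 8 * (d k)\<^sup>2)"
    by (simp only: \<kappa>_def mult.assoc)
  ultimately show ?thesis using R'_drop[of k] by linarith
qed

lemma R'_diff_tendsto: "(\<lambda>k. R' k - R' (Suc k)) \<longlonglongrightarrow> 0"
  using tendsto_diff[OF R'_tendsto LIMSEQ_Suc[OF R'_tendsto]] by simp

lemma R'_minus_h_tendsto: "(\<lambda>k. R' k - h k) \<longlonglongrightarrow> 0"
proof (rule real_tendsto_sandwich)
  show "\<forall>\<^sub>F k in sequentially. 0 \<le> R' k - h k" using h_le by (simp add: always_eventually)
  show "\<forall>\<^sub>F k in sequentially. R' k - h k \<le> (R' k - R' (Suc k)) / pmin"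
    using R'_drop pmin by (intro always_eventually) (auto simp: field_simps)
  show "(\<lambda>k. (R' k - R' (Suc k)) / pmin) \<longlonglongrightarrow> 0"
    using tendsto_divide_zero[OF R'_diff_tendsto] .
qed simp

lemma h_tendsto: "h \<longlonglongrightarrow> Rlim"
  using tendsto_diff[OF R'_tendsto R'_minus_h_tendsto] by simp

text \<open>Stronger than the convergence of \<open>d\<close>, as no bound on the step sizes
  \<open>\<gamma> k\<close> over all \<open>k\<close> is available. It shows that the quadratic term
  of the potential vanishes in the limit.\<close>

lemma \<gamma>_d_tendsto: "(\<lambda>k. \<gamma> k * (d k)\<^sup>2) \<longlonglongrightarrow> 0"
proof (rule real_tendsto_sandwich)
  show "\<forall>\<^sub>F k in sequentially. 0 \<le> \<gamma> k * (d k)\<^sup>2"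
    using \<gamma>_ge gamma by (intro always_eventually allI mult_nonneg_nonneg) (auto intro: order_trans less_imp_le)
  have "\<gamma> k * (d k)\<^sup>2 \<le> 8 / (1 - \<delta>) * (R' k - h k)" for k
    using h_decrease[of k] delta by (simp add: field_simps)
  then show "\<forall>\<^sub>F k in sequentially. \<gamma> k * (d k)\<^sup>2 \<le> 8 / (1 - \<delta>) * (R' k - h k)" by simp
  show "(\<lambda>k. 8 / (1 - \<delta>) * (R' k - h k)) \<longlonglongrightarrow> 0"
    using tendsto_mult_right_zero[OF R'_minus_h_tendsto] .
qed simp

lemma d_tendsto: "d \<longlonglongrightarrow> 0"
proof -
  have "(\<lambda>k. (d k)\<^sup>2) \<longlonglongrightarrow> 0"
  proof (rule real_tendsto_sandwich)
    show "\<forall>\<^sub>F k in sequentially. 0 \<le> (d k)\<^sup>2" by simp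
    show "\<forall>\<^sub>F k in sequentially. (d k)\<^sup>2 \<le> (R' k - R' (Suc k)) / \<kappa>"
      using R'_square_decrease \<kappa>_pos by (intro always_eventually) (auto simp: field_simps)
    show "(\<lambda>k. (R' k - R' (Suc k)) / \<kappa>) \<longlonglongrightarrow> 0"
      using tendsto_divide_zero[OF R'_diff_tendsto] .
  qed simp
  then show ?thesis by simp
qed

section \<open>Extrapolation and boundedness of the step sizes near the accumulation point\<close>

lemma e_Suc: "e (Suc k) = d k" by (simp add: e_def d_def)

lemma e_tendsto: "e \<longlonglongrightarrow> 0"
  using d_tendsto by (subst filterlim_sequentially_Suc[symmetric]) (simp add: e_Suc)

lemma \<eta>_less_1: "\<eta> < 1" "\<tau> * \<eta>\<^sup>2 < 1"
proof -
  have s: "1 < sqrt \<tau>" using tau by simp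
  have m: "\<eta> * sqrt \<tau> < 1" using eta(2) s by (simp add: pos_less_divide_eq)
  then show "\<eta> < 1" using s eta by (smt (verit) mult_le_cancel_left1)
  have "(\<eta> * sqrt \<tau>)\<^sup>2 < 1" using m eta s by (simp add: power_less_one_iff abs_square_less_1)
  then show "\<tau> * \<eta>\<^sup>2 < 1" using tau by (simp add: power_mult_distrib mult.commute)
qed

lemma extrapolation_bound: "0 \<le> \<eta> ^ i * \<beta>0 k" "\<eta> ^ i * \<beta>0 k \<le> \<eta> ^ i * (\<delta> * \<beta>max)" "\<eta> ^ i * \<beta>0 k \<le> \<beta>max"
proof -
  have b: "0 \<le> \<beta>0 k" "\<beta>0 k \<le> \<delta> * \<beta>max" using \<beta>0[of k] by auto
  then show "0 \<le> \<eta> ^ i * \<beta>0 k" "\<eta> ^ i * \<beta>0 k \<le> \<eta> ^ i * (\<delta> * \<beta>max)" using eta by auto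
  have "\<delta> * \<beta>max \<le> \<beta>max" using delta beta mult_right_mono[of \<delta> 1 \<beta>max] by simp
  moreover have "\<eta> ^ i * \<beta>0 k \<le> 1 * \<beta>0 k"
    using b eta \<eta>_less_1 by (intro mult_right_mono power_le_one) auto
  ultimately show "\<eta> ^ i * \<beta>0 k \<le> \<beta>max" using b by linarith
qed

lemma y_close: "norm (y k - x k) \<le> \<beta>max * e k"
  using extrapolation_bound[of "acc k" k] by (simp add: y_def e_def mult_right_mono)

text \<open>Recentres the quadratic term from the extrapolated point \<open>u\<close> to
  \<open>w\<close>. The squares of \<open>norm (w - u)\<close> on both sides cancel, and only a
  cross term remains.\<close>

lemma prox_le_shifted:
  assumes "prox \<zeta> u c z" "w \<in> effdom P1" "0 \<le> c"
  shows "p1 z + (g u - \<zeta>) \<bullet> (z - w) + c / 2 * (norm (z - w))\<^sup>2 \<le> p1 w + c * (norm (z - w) * norm (w - u))"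
proof -
  have "(norm (z - u))\<^sup>2 = (norm (z - w))\<^sup>2 + 2 * ((z - w) \<bullet> (w - u)) + (norm (w - u))\<^sup>2"
    unfolding power2_norm_eq_inner by (simp add: inner_diff_left inner_diff_right inner_commute)
  then have "c / 2 * (norm (z - u))\<^sup>2 = c / 2 * (norm (z - w))\<^sup>2 + c * ((z - w) \<bullet> (w - u)) + c / 2 * (norm (w - u))\<^sup>2"
    by (simp add: distrib_left)
  moreover have "(g u - \<zeta>) \<bullet> (z - u) = (g u - \<zeta>) \<bullet> (z - w) + (g u - \<zeta>) \<bullet> (w - u)"
    by (simp add: inner_diff_right)
  moreover have "- ((z - w) \<bullet> (w - u)) \<le> norm (z - w) * norm (w - u)"
    using norm_cauchy_schwarz[of "- (z - w)" "w - u"] by (simp only: inner_minus_left norm_minus_cancel)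
  then have "c * (- ((z - w) \<bullet> (w - u))) \<le> c * (norm (z - w) * norm (w - u))"
    using assms(3) by (rule mult_left_mono)
  then have "- (c * ((z - w) \<bullet> (w - u))) \<le> c * (norm (z - w) * norm (w - u))"
    by (simp only: mult_minus_right)
  ultimately show ?thesis using prox_le[OF assms(1,2)] by linarith
qed

text \<open>With \<open>t = norm (z - w)\<close> and \<open>s = norm (w - u)\<close>, the bound
  \<open>4 * L \<le> c\<close> leaves \<open>- c / 4 * t\<^sup>2 + 5 / 4 * c * t * s\<close>.
  Spending \<open>c / 8 * t\<^sup>2\<close> on the cross term costs
  \<open>25 / 8 * c * s\<^sup>2\<close>, rounded up to 4.\<close>

lemma trial_descent:
  assumes prox: "prox \<zeta> u c z" and w: "w \<in> effdom P1" and \<zeta>: "\<And>q. P2 w + \<zeta> \<bullet> (q - w) \<le> P2 q"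
    and L: "L-lipschitz_on (ball v \<rho>) g" and ball: "w \<in> ball v \<rho>" "u \<in> ball v \<rho>" "z \<in> ball v \<rho>"
    and c: "4 * L \<le> c"
  shows "F z + c / 8 * (norm (z - w))\<^sup>2 \<le> F w + 4 * (c * (norm (w - u))\<^sup>2)"
proof -
  define t s where "t = norm (z - w)" and "s = norm (w - u)"
  have "0 \<le> L" using lipschitz_on_nonneg[OF L] .
  then have "0 \<le> c" using c by simp
  have f: "f z - f w \<le> g u \<bullet> (z - w) + L * t\<^sup>2 + L * s * t"
    unfolding t_def s_def by (rule gradient_lipschitz_ascent[OF g_gradient L ball])
  have p: "p1 z + (g u - \<zeta>) \<bullet> (z - w) + c / 2 * t\<^sup>2 \<le> p1 w + c * (t * s)"
    unfolding t_def s_def by (rule prox_le_shifted[OF prox w \<open>0 \<le> c\<close>])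
  have 1: "L * t\<^sup>2 \<le> c / 4 * t\<^sup>2" using c by (intro mult_right_mono) auto
  have "L * (s * t) \<le> c / 4 * (s * t)" using c by (intro mult_right_mono) (auto simp: s_def t_def)
  then have 2: "L * s * t \<le> c / 4 * (t * s)" by (simp add: mult_ac)
  have "0 \<le> c * (t - 5 * s)\<^sup>2" using \<open>0 \<le> c\<close> by simp
  then have 3: "10 * (c * (t * s)) \<le> c * t\<^sup>2 + 25 * (c * s\<^sup>2)"
    by (simp add: power2_eq_square algebra_simps)
  have 4: "0 \<le> c * s\<^sup>2" "0 \<le> c * t\<^sup>2" using \<open>0 \<le> c\<close> by simp_all
  have i: "(g u - \<zeta>) \<bullet> (z - w) = g u \<bullet> (z - w) - \<zeta> \<bullet> (z - w)" by (simp add: inner_diff_left)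
  have "f z + p1 z - P2 z + c / 8 * t\<^sup>2 \<le> f w + p1 w - P2 w + 4 * (c * s\<^sup>2)"
    using f p 1 2 3 4 \<zeta>[of z] unfolding i by simp
  then show ?thesis by (simp add: F_def t_def s_def)
qed

text \<open>Forces trials with large \<open>c\<close> to lie near \<open>w\<close>, so that a local
  Lipschitz constant of \<open>g\<close> becomes usable. Of the growth \<open>c / 2\<close>, the
  cross term takes \<open>c / 4\<close>, the lower bound of \<open>P1\<close> takes
  \<open>c0\<close>, and the linear term takes 1.\<close>

lemma trial_close:
  assumes prox: "prox \<zeta> u c z" and w: "w \<in> effdom P1" and "0 \<le> c" "0 \<le> c0"
    and lower: "\<And>q. ereal (- B - c0 / 2 * (norm q)\<^sup>2) \<le> P1 q"
    and G: "norm (g u - \<zeta>) \<le> G" and E: "c * (norm (w - u))\<^sup>2 \<le> E"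
  shows "(c / 4 - c0 - 1) * (norm (z - w))\<^sup>2 \<le> p1 w + B + c0 * (norm w)\<^sup>2 + G\<^sup>2 + E"
proof -
  define t s where "t = norm (z - w)" and "s = norm (w - u)"
  have p: "p1 z + (g u - \<zeta>) \<bullet> (z - w) + c / 2 * t\<^sup>2 \<le> p1 w + c * (t * s)"
    unfolding t_def s_def by (rule prox_le_shifted[OF prox w \<open>0 \<le> c\<close>])
  have "- ((g u - \<zeta>) \<bullet> (z - w)) \<le> norm (g u - \<zeta>) * t"
    using norm_cauchy_schwarz[of "- (g u - \<zeta>)" "z - w"] by (simp only: t_def inner_minus_left norm_minus_cancel)
  also have "\<dots> \<le> G * t" using G by (simp add: t_def mult_right_mono)
  also have "\<dots> \<le> G\<^sup>2 + t\<^sup>2"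
    using zero_le_power2[of "G - t"] zero_le_power2[of "G + t"] by (simp add: power2_eq_square algebra_simps)
  finally have 1: "- ((g u - \<zeta>) \<bullet> (z - w)) \<le> G\<^sup>2 + t\<^sup>2" .
  have "0 \<le> c * (t - 2 * s)\<^sup>2" using \<open>0 \<le> c\<close> by simp
  then have 2: "4 * (c * (t * s)) \<le> c * t\<^sup>2 + 4 * (c * s\<^sup>2)"
    by (simp add: power2_eq_square algebra_simps)
  have "norm z \<le> norm w + t" using norm_triangle_ineq[of w "z - w"] by (simp add: t_def)
  then have "(norm z)\<^sup>2 \<le> (norm w + t)\<^sup>2" by (intro power_mono) auto
  also have "\<dots> \<le> 2 * (norm w)\<^sup>2 + 2 * t\<^sup>2"
    using zero_le_power2[of "norm w - t"] by (simp add: power2_eq_square algebra_simps)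
  finally have "c0 * (norm z)\<^sup>2 \<le> c0 * (2 * (norm w)\<^sup>2 + 2 * t\<^sup>2)"
    using \<open>0 \<le> c0\<close> by (rule mult_left_mono)
  then have 3: "c0 / 2 * (norm z)\<^sup>2 \<le> c0 * (norm w)\<^sup>2 + c0 * t\<^sup>2" by (simp add: algebra_simps)
  have 4: "- B - c0 / 2 * (norm z)\<^sup>2 \<le> p1 z" using lower[of z] by (simp add: P1_eq[OF prox_dom[OF prox]])
  have "c / 4 * t\<^sup>2 - c0 * t\<^sup>2 - t\<^sup>2 \<le> p1 w + B + c0 * (norm w)\<^sup>2 + G\<^sup>2 + E"
    using p 1 2 3 4 E unfolding s_def[symmetric] by simp
  then show ?thesis by (simp add: t_def left_diff_distrib)
qed

text \<open>The run may choose any minimizer as trial, so all minimizers at index \<open>i\<close>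
  must pass the test to guarantee a stop by then.\<close>

lemma acc_le:
  assumes ex: "\<exists>z. prox (\<xi> k) (x k + (\<eta> ^ i * \<beta>0 k) *\<^sub>R (x k - x (k - 1))) (\<tau> ^ i * \<gamma>0 k) z"
    and ok: "\<And>z. prox (\<xi> k) (x k + (\<eta> ^ i * \<beta>0 k) *\<^sub>R (x k - x (k - 1))) (\<tau> ^ i * \<gamma>0 k) z \<Longrightarrow>
      F z + \<tau> ^ i * \<gamma>0 k / 8 * (norm (z - x k))\<^sup>2 \<le> R' k"
  shows "acc k \<le> i"
proof (rule ccontr)
  assume "\<not> acc k \<le> i"
  then have "prox (\<xi> k) (x k + (\<eta> ^ i * \<beta>0 k) *\<^sub>R (x k - x (k - 1))) (\<tau> ^ i * \<gamma>0 k) (trial k i)"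
    and "\<not> line_search_ok f P1 P2 \<delta> (R k) (x k) (\<tau> ^ i * \<gamma>0 k) (trial k i)"
    using acc[of i k] ex by auto
  then show False using ok[of "trial k i"] by (simp add: R_eq line_search_real prox_dom)
qed

text \<open>By \<open>h_le_Suc\<close>, the new reference value still contains the quadratic term of
  the preceding potential value. This is the budget for the extrapolation error.\<close>

lemma e_le_R': "F (x k) + \<delta> * \<gamma>min / 8 * (e k)\<^sup>2 \<le> R' k"
proof (cases k)
  case (Suc j)
  have "\<delta> * \<gamma>min / 8 * (d j)\<^sup>2 \<le> \<delta> * \<gamma> j / 8 * (d j)\<^sup>2"
    using \<gamma>_ge delta by (intro mult_right_mono divide_right_mono mult_left_mono) auto
  then show ?thesis using h_le_Suc[of j] by (simp add: Suc e_Suc h_def)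
qed (simp add: R'_0 e_def)

text \<open>The condition \<open>\<eta> < 1 / sqrt \<tau>\<close> makes \<open>\<gamma>\<^sub>i \<beta>\<^sub>i\<^sup>2\<close> decay
  geometrically, so the term \<open>\<delta> \<gamma>min / 8 * (e k)\<^sup>2\<close> of the potential pays for the extrapolation.\<close>

lemma extrapolation_error:
  "\<tau> ^ i * \<gamma>0 k * (norm (x k - (x k + (\<eta> ^ i * \<beta>0 k) *\<^sub>R (x k - x (k - 1)))))\<^sup>2
    \<le> (\<tau> * \<eta>\<^sup>2) ^ i * (\<gamma>max * \<beta>max\<^sup>2) * (\<delta> * (e k)\<^sup>2)"
proof -
  have "norm (x k - (x k + (\<eta> ^ i * \<beta>0 k) *\<^sub>R (x k - x (k - 1)))) = \<eta> ^ i * \<beta>0 k * e k"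
    using extrapolation_bound(1)[of i k] by (simp add: e_def)
  also have "\<dots> \<le> \<eta> ^ i * (\<delta> * \<beta>max) * e k"
    using extrapolation_bound(2)[of i k] by (intro mult_right_mono) (auto simp: e_def)
  finally have a: "(norm (x k - (x k + (\<eta> ^ i * \<beta>0 k) *\<^sub>R (x k - x (k - 1)))))\<^sup>2 \<le> (\<eta> ^ i * (\<delta> * \<beta>max) * e k)\<^sup>2"
    by (intro power_mono) auto
  have b: "\<tau> ^ i * \<gamma>0 k \<le> \<tau> ^ i * \<gamma>max" "0 \<le> \<tau> ^ i * \<gamma>max"
    using \<gamma>0[of k] tau gamma by auto
  have "\<tau> ^ i * \<gamma>0 k * (norm (x k - (x k + (\<eta> ^ i * \<beta>0 k) *\<^sub>R (x k - x (k - 1)))))\<^sup>2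
      \<le> \<tau> ^ i * \<gamma>max * (\<eta> ^ i * (\<delta> * \<beta>max) * e k)\<^sup>2"
    by (rule mult_mono[OF b(1) a b(2)]) simp
  also have "\<dots> = ((\<tau> * \<eta>\<^sup>2) ^ i * (\<gamma>max * \<beta>max\<^sup>2)) * (\<delta>\<^sup>2 * (e k)\<^sup>2)"
    by (simp add: power_mult_distrib power2_eq_square mult_ac)
  \<comment> \<open>From \<open>\<delta>\<^sup>2 \<le> \<delta>\<close>; one factor
    \<open>\<delta>\<close> is kept to match the budget in \<open>e_le_R'\<close>, also when
    \<open>\<delta> = 0\<close>.\<close>
  also have "\<dots> \<le> ((\<tau> * \<eta>\<^sup>2) ^ i * (\<gamma>max * \<beta>max\<^sup>2)) * (\<delta> * (e k)\<^sup>2)"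
    using delta tau gamma power_decreasing[of 1 2 \<delta>] by (intro mult_left_mono mult_right_mono) auto
  finally show ?thesis .
qed

text \<open>One index \<open>i\<close>, independent of \<open>k\<close>, is found at which every
  minimizer passes the line search whenever \<open>x k\<close> is near \<open>xs\<close>. First
  \<open>trial_close\<close> keeps the trial in the Lipschitz ball, then
  \<open>trial_descent\<close> applies there.\<close>

lemma stepsize_bounded_near:
  obtains \<rho> \<Gamma> where "\<rho> > 0" "\<forall>\<^sub>F k in sequentially. dist (x k) xs < \<rho> \<longrightarrow> \<gamma> k \<le> \<Gamma>"
proof -
  obtain r0 L where r0: "r0 > 0" and L0: "L-lipschitz_on (ball xs r0) g"
    using f_lip unfolding locally_lipschitz_on_def Int_UNIV_right by blast
  define r1 where "r1 = min r0 1"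
  have r1: "r1 > 0" "r1 \<le> 1" using r0 by (auto simp: r1_def)
  have L: "L-lipschitz_on (ball xs r1) g" using L0 by (rule lipschitz_on_subset) (auto simp: r1_def)
  obtain c0 B where c0: "c0 > 0" and lower: "\<And>z. ereal (- B - c0 / 2 * (norm z)\<^sup>2) \<le> P1 z"
    using prox_bounded_lower[OF P1_prox_bounded] by metis
  obtain M1 where M1: "\<And>w \<zeta>. dist w xs \<le> 1 \<Longrightarrow> (\<And>z. P2 w + \<zeta> \<bullet> (z - w) \<le> P2 z) \<Longrightarrow> norm \<zeta> \<le> M1"
    using subgradient_bounded[OF P2_convex] by metis
  have bd: "\<exists>M. \<forall>w. dist w xs \<le> 1 \<longrightarrow> norm (q w) \<le> M" if "continuous_on UNIV q" for q :: "'a \<Rightarrow> 'b::real_normed_vector"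
  proof -
    have "bounded (q ` cball xs 1)"
      using that by (intro compact_imp_bounded compact_continuous_image) (auto intro: continuous_on_subset)
    then show ?thesis unfolding bounded_iff by (metis dist_commute imageI mem_cball)
  qed
  obtain M2 where M2: "\<And>w. dist w xs \<le> 1 \<Longrightarrow> norm (g w) \<le> M2"
    using bd[OF cont_g] by blast
  obtain M3 where M3: "\<And>w. dist w xs \<le> 1 \<Longrightarrow> norm (P2 w - f w) \<le> M3"
    using bd[OF continuous_on_diff[OF cont_P2 cont_f]] by blast
  \<comment> \<open>\<open>C\<close> dominates the right side of \<open>trial_close\<close>;
    \<open>\<Lambda>\<close> contradicts that bound as soon as the trial is \<open>r1 / 2\<close>
    away, the 1 making it strict. \<open>\<Gamma>0\<close> is the threshold on \<open>c\<close> for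
    both trial lemmas.\<close>
  define C where "C = R' 0 + M3 + B + c0 * (norm xs + 1)\<^sup>2 + (M1 + M2)\<^sup>2 + \<gamma>max * \<beta>max\<^sup>2"
  define \<Lambda> where "\<Lambda> = (\<bar>C\<bar> + 1) / (r1 / 2)\<^sup>2"
  define \<Gamma>0 where "\<Gamma>0 = max (4 * L) (4 * (c0 + 1 + \<Lambda>))"
  \<comment> \<open>The factor 32 is 4 from \<open>trial_descent\<close> times 8 from
    \<open>\<delta> * \<gamma>min / 8\<close> in \<open>e_le_R'\<close>.\<close>
  have "(\<lambda>i. (\<tau> * \<eta>\<^sup>2) ^ i * (32 * (\<gamma>max * \<beta>max\<^sup>2))) \<longlonglongrightarrow> 0 * (32 * (\<gamma>max * \<beta>max\<^sup>2))"
    using \<eta>_less_1(2) tau by (intro tendsto_mult LIMSEQ_power_zero tendsto_const) simp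
  then have "\<forall>\<^sub>F i in sequentially. (\<tau> * \<eta>\<^sup>2) ^ i * (32 * (\<gamma>max * \<beta>max\<^sup>2)) < \<gamma>min"
    using gamma by (intro order_tendstoD(2)) auto
  moreover have "\<forall>\<^sub>F i in sequentially. \<Gamma>0 / \<gamma>min < \<tau> ^ i"
    using filterlim_realpow_sequentially_gt1[of \<tau>] tau
    by (auto simp: filterlim_at_infinity_imp_norm_at_top filterlim_at_top_dense
        dest!: filterlim_at_infinity_imp_norm_at_top elim!: allE[of _ "\<Gamma>0 / \<gamma>min"])
  ultimately have "\<forall>\<^sub>F i in sequentially. (\<tau> * \<eta>\<^sup>2) ^ i * (32 * (\<gamma>max * \<beta>max\<^sup>2)) < \<gamma>min \<and> \<Gamma>0 / \<gamma>min < \<tau> ^ i"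
    by (rule eventually_conj)
  then obtain i where i: "(\<tau> * \<eta>\<^sup>2) ^ i * (32 * (\<gamma>max * \<beta>max\<^sup>2)) < \<gamma>min" "\<Gamma>0 / \<gamma>min < \<tau> ^ i"
    using eventually_happens'[OF sequentially_bot] by blast
  have "(\<lambda>k. \<beta>max * e k) \<longlonglongrightarrow> 0" using tendsto_mult_right_zero[OF e_tendsto] .
  then have "\<forall>\<^sub>F k in sequentially. \<beta>max * e k < r1 / 4" using r1 by (intro order_tendstoD(2)) auto
  moreover have "\<forall>\<^sub>F k in sequentially. e k < 1" using e_tendsto by (rule order_tendstoD(2)) simp
  ultimately have "\<forall>\<^sub>F k in sequentially. dist (x k) xs < r1 / 4 \<longrightarrow> acc k \<le> i"
  proof eventually_elim
    case (elim k)
    show ?case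
    proof
      assume near: "dist (x k) xs < r1 / 4"
      define u where "u = x k + (\<eta> ^ i * \<beta>0 k) *\<^sub>R (x k - x (k - 1))"
      define c where "c = \<tau> ^ i * \<gamma>0 k"
      have "\<Gamma>0 < \<tau> ^ i * \<gamma>min" using i(2) gamma(1) by (simp add: pos_divide_less_eq)
      also have "\<dots> \<le> c" using \<gamma>0[of k] tau by (simp add: c_def)
      finally have c: "\<Gamma>0 < c" .
      have "4 * L < c \<and> 4 * (c0 + 1 + \<Lambda>) < c"
        using c unfolding \<Gamma>0_def by (simp only: max_less_iff_conj)
      then have cL: "4 * L \<le> c" "c0 + 1 + \<Lambda> < c / 4"
        by auto
      have "0 \<le> \<Lambda>" by (simp add: \<Lambda>_def)
      then have cpos: "0 < c" "c0 < c" using cL(2) c0 by linarith+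
      have "norm (u - x k) = \<eta> ^ i * \<beta>0 k * e k"
        using extrapolation_bound(1)[of i k] by (simp add: u_def e_def)
      also have "\<dots> \<le> \<beta>max * e k"
        using extrapolation_bound(3)[of i k] by (intro mult_right_mono) (auto simp: e_def)
      finally have "norm (u - x k) < r1 / 4" using elim(1) by linarith
      then have u: "dist u xs < r1 / 2"
        using near dist_triangle[of u xs "x k"] by (simp add: dist_norm)
      have err: "c * (norm (x k - u))\<^sup>2 \<le> (\<tau> * \<eta>\<^sup>2) ^ i * (\<gamma>max * \<beta>max\<^sup>2) * (\<delta> * (e k)\<^sup>2)"
        unfolding c_def u_def by (rule extrapolation_error)
      have e1: "\<delta> * (e k)\<^sup>2 \<le> 1"
        using delta elim(2) by (intro mult_le_one power_le_one) (auto simp: e_def)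
      have Q: "0 \<le> \<gamma>max * \<beta>max\<^sup>2" using gamma by simp
      have th: "(\<tau> * \<eta>\<^sup>2) ^ i \<le> 1" "0 \<le> (\<tau> * \<eta>\<^sup>2) ^ i" using \<eta>_less_1(2) tau by (auto intro!: power_le_one)
      have "(\<tau> * \<eta>\<^sup>2) ^ i * (\<gamma>max * \<beta>max\<^sup>2) * (\<delta> * (e k)\<^sup>2) \<le> 1 * (\<gamma>max * \<beta>max\<^sup>2) * 1"
        using th Q e1 delta gamma by (intro mult_mono) auto
      with err have E: "c * (norm (x k - u))\<^sup>2 \<le> \<gamma>max * \<beta>max\<^sup>2" by simp
      have "(\<tau> * \<eta>\<^sup>2) ^ i * (32 * (\<gamma>max * \<beta>max\<^sup>2)) * (\<delta> * (e k)\<^sup>2) \<le> \<gamma>min * (\<delta> * (e k)\<^sup>2)"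
        using i(1) delta by (intro mult_right_mono) auto
      with err have err': "4 * (c * (norm (x k - u))\<^sup>2) \<le> \<delta> * \<gamma>min / 8 * (e k)\<^sup>2"
        by (simp add: mult_ac)
      have "norm (g u - \<xi> k) \<le> norm (g u) + norm (\<xi> k)" by (rule norm_triangle_ineq4)
      also have "\<dots> \<le> M1 + M2"
        using M1[OF _ \<xi>_subgradient, of k] M2[of u] u near r1 by force
      finally have G: "norm (g u - \<xi> k) \<le> M1 + M2" .
      have "p1 (x k) = F (x k) + (P2 (x k) - f (x k))" by (simp add: F_def)
      also have "\<dots> \<le> R' 0 + M3"
        using M3[of "x k"] near r1 F_le_R'[of k] decseqD[OF R'_decseq, of 0 k] by (simp add: abs_le_iff)
      finally have p1: "p1 (x k) \<le> R' 0 + M3" .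
      have "norm (x k) \<le> norm xs + 1"
        using near r1 norm_triangle_ineq[of "x k - xs" xs] by (simp add: dist_norm)
      then have "c0 * (norm (x k))\<^sup>2 \<le> c0 * (norm xs + 1)\<^sup>2"
        using c0 by (intro mult_left_mono power_mono) auto
      with p1 have Cb: "p1 (x k) + B + c0 * (norm (x k))\<^sup>2 + (M1 + M2)\<^sup>2 + \<gamma>max * \<beta>max\<^sup>2 \<le> C"
        unfolding C_def by linarith
      have ok: "F z + c / 8 * (norm (z - x k))\<^sup>2 \<le> R' k" if z: "prox (\<xi> k) u c z" for z
      proof -
        have close: "(c / 4 - c0 - 1) * (norm (z - x k))\<^sup>2 \<le> C"
          using trial_close[OF z x_dom _ _ lower G E] cpos c0 Cb by simp
        have "norm (z - x k) < r1 / 2"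
        proof (rule ccontr)
          assume "\<not> norm (z - x k) < r1 / 2"
          then have "(r1 / 2)\<^sup>2 \<le> (norm (z - x k))\<^sup>2" using r1 by (intro power_mono) auto
          moreover have "\<Lambda> \<le> c / 4 - c0 - 1" using cL(2) by simp
          ultimately have "\<Lambda> * (r1 / 2)\<^sup>2 \<le> (c / 4 - c0 - 1) * (norm (z - x k))\<^sup>2"
            using \<open>0 \<le> \<Lambda>\<close> by (intro mult_mono) (auto intro: order_trans)
          moreover have "\<Lambda> * (r1 / 2)\<^sup>2 = \<bar>C\<bar> + 1" using r1 by (simp add: \<Lambda>_def)
          ultimately show False using close by linarith
        qed
        then have "dist z xs < r1" using near r1(1) dist_triangle[of z xs "x k"] by (simp add: dist_norm)
        then have "F z + c / 8 * (norm (z - x k))\<^sup>2 \<le> F (x k) + 4 * (c * (norm (x k - u))\<^sup>2)"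
          using near u r1 cL(1) by (intro trial_descent[OF z x_dom \<xi>_subgradient L]) (auto simp: dist_commute)
        with err' e_le_R'[of k] show ?thesis by linarith
      qed
      have "\<exists>z. prox (\<xi> k) u c z"
        by (rule model_minimizer_exists[OF P1_closed P1_proper lower cpos(2)])
      from this ok show "acc k \<le> i" unfolding u_def c_def by (rule acc_le)
    qed
  qed
  then have "\<forall>\<^sub>F k in sequentially. dist (x k) xs < r1 / 4 \<longrightarrow> \<gamma> k \<le> \<tau> ^ i * \<gamma>max"
  proof eventually_elim
    case (elim k)
    show ?case
    proof
      assume "dist (x k) xs < r1 / 4"
      then show "\<gamma> k \<le> \<tau> ^ i * \<gamma>max"
        unfolding \<gamma>_def using elim \<gamma>0[of k] tau gamma by (intro mult_mono power_increasing) auto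
    qed
  qed
  with r1 show thesis by (intro that[of "r1 / 4"]) auto
qed

section \<open>Stationarity and value of the accumulation point\<close>

lemma optimality:
  "- (g (y k) - \<xi> k + \<gamma> k *\<^sub>R (x (Suc k) - y k)) \<in> frechet_subdiff P1 (x (Suc k))"
proof -
  define m where "m = nexPGA_model g P1 (\<xi> k) (y k) (\<gamma> k)"
  define s where "s z = (g (y k) - \<xi> k) \<bullet> (z - y k) + \<gamma> k / 2 * ((z - y k) \<bullet> (z - y k))" for z
  have m: "m z = ereal (s z) + P1 z" for z
    by (simp add: m_def s_def nexPGA_model_def power2_norm_eq_inner)
  have "0 \<in> frechet_subdiff m (x (Suc k))"
    using x_prox[of k] unfolding m_def[symmetric]
    by (intro global_minimizer_frechet) (auto simp: is_arg_min_def not_less m P1_eq[OF x_dom])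
  \<comment> \<open>Adding \<open>- s\<close> to the model removes its smooth part and leaves a
    subgradient of \<open>P1\<close>.\<close>
  moreover have "((\<lambda>z. - s z) has_derivative
      (\<lambda>z. - (g (y k) - \<xi> k + \<gamma> k *\<^sub>R (x (Suc k) - y k)) \<bullet> z)) (at (x (Suc k)))"
    unfolding s_def
    by (auto intro!: derivative_eq_intros
        simp: fun_eq_iff inner_add_left inner_diff_left inner_diff_right inner_commute algebra_simps)
  ultimately have "0 + - (g (y k) - \<xi> k + \<gamma> k *\<^sub>R (x (Suc k) - y k))
      \<in> frechet_subdiff (\<lambda>z. m z + ereal (- s z)) (x (Suc k))"
    by (rule frechet_subdiff_add_smooth)
  moreover have "m z + ereal (- s z) = P1 z" for z by (cases "P1 z") (auto simp: m)
  ultimately show ?thesis by simp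
qed

lemma xs_dom: "xs \<in> effdom P1"
proof -
  have lim: "(\<lambda>n. x (r n)) \<longlonglongrightarrow> xs" using r(2) by (simp add: comp_def)
  have "P1 (x (r n)) \<le> ereal (R' 0 - f (x (r n)) + P2 (x (r n)))" for n
    using F_le_R'[of "r n"] decseqD[OF R'_decseq, of 0 "r n"] by (simp add: P1_eq x_dom F_def)
  then have "\<forall>\<^sub>F n in sequentially. P1 (x (r n)) \<le> ereal (R' 0 - f (x (r n)) + P2 (x (r n)))"
    by (intro always_eventually allI)
  moreover have "(\<lambda>n. ereal (R' 0 - f (x (r n)) + P2 (x (r n)))) \<longlonglongrightarrow> ereal (R' 0 - f xs + P2 xs)"
    by (intro tendsto_ereal tendsto_intros tendsto_f tendsto_P2 lim)
  ultimately have "P1 xs \<le> ereal (R' 0 - f xs + P2 xs)"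
    by (rule lsc_le_limit[OF P1_closed lim])
  then show ?thesis unfolding effdom_def using le_less_trans[of "P1 xs" _ \<infinity>] by simp
qed

text \<open>Along a further subsequence the step sizes are bounded and \<open>\<xi>\<close>
  converges. The optimality conditions then pass to the limit, once the values of \<open>P1\<close>
  are known to converge too.\<close>

lemma accumulation_point:
  shows accumulation_stationary: "stationary_point f g P1 P2 xs"
    and accumulation_value: "F xs = Rlim"
proof -
  obtain \<rho> \<Gamma> where \<Gamma>: "\<rho> > 0" "\<forall>\<^sub>F k in sequentially. dist (x k) xs < \<rho> \<longrightarrow> \<gamma> k \<le> \<Gamma>"
    using stepsize_bounded_near by metis
  obtain M where M: "\<And>w \<zeta>. dist w xs \<le> 1 \<Longrightarrow> (\<And>z. P2 w + \<zeta> \<bullet> (z - w) \<le> P2 z) \<Longrightarrow> norm \<zeta> \<le> M"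
    using subgradient_bounded[OF P2_convex] by metis
  have rlim: "filterlim r at_top sequentially" using r(1) by (rule filterlim_subseq)
  have "\<forall>\<^sub>F j in sequentially. dist ((x \<circ> r) j) xs < min \<rho> 1"
    using \<open>\<rho> > 0\<close> by (intro tendstoD[OF r(2)]) simp
  with eventually_compose_filterlim[OF \<Gamma>(2) rlim]
  have "\<forall>\<^sub>F j in sequentially. \<gamma> (r j) \<le> \<Gamma> \<and> norm (\<xi> (r j)) \<le> M"
    by eventually_elim (use M[OF _ \<xi>_subgradient] in auto)
  then obtain J where J: "\<And>j. j \<ge> J \<Longrightarrow> \<gamma> (r j) \<le> \<Gamma> \<and> norm (\<xi> (r j)) \<le> M"
    unfolding eventually_sequentially by blast
  have "bounded (range (\<lambda>j. \<xi> (r (j + J))))"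
    unfolding bounded_iff using J by (auto intro!: exI[of _ M])
  then obtain \<xi>s s where s: "strict_mono s" "((\<lambda>j. \<xi> (r (j + J))) \<circ> s) \<longlonglongrightarrow> \<xi>s"
    using bounded_imp_convergent_subsequence by blast
  define q where "q j = r (s j + J)" for j
  have q: "strict_mono q"
    using r(1) s(1) by (auto simp: q_def strict_mono_def)
  have q\<xi>: "(\<lambda>j. \<xi> (q j)) \<longlonglongrightarrow> \<xi>s" using s(2) by (simp only: q_def comp_def)
  have q\<gamma>: "\<gamma> (q j) \<le> \<Gamma>" for j using J[of "s j + J"] by (simp add: q_def)
  have "(\<lambda>j. (x \<circ> r) (j + J)) \<longlonglongrightarrow> xs" using LIMSEQ_ignore_initial_segment[OF r(2)] .
  from LIMSEQ_subseq_LIMSEQ[OF this s(1)]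
  have qx: "(\<lambda>j. x (q j)) \<longlonglongrightarrow> xs" by (simp add: q_def comp_def)
  have sub: "(\<lambda>j. a (q j)) \<longlonglongrightarrow> l" if "a \<longlonglongrightarrow> l" for a :: "nat \<Rightarrow> real" and l
    using LIMSEQ_subseq_LIMSEQ[OF that q] by (simp add: comp_def)
  have "(\<lambda>j. x (Suc (q j)) - x (q j)) \<longlonglongrightarrow> 0"
    using sub[OF d_tendsto] unfolding d_def by (rule tendsto_norm_zero_cancel)
  from tendsto_add[OF this qx] have qxS: "(\<lambda>j. x (Suc (q j))) \<longlonglongrightarrow> xs" by simp
  have "(\<lambda>j. \<beta>max * e (q j)) \<longlonglongrightarrow> 0" using tendsto_mult_right_zero[OF sub[OF e_tendsto]] .
  then have "(\<lambda>j. y (q j) - x (q j)) \<longlonglongrightarrow> 0"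
    by (rule Lim_null_comparison[rotated]) (use y_close in auto)
  from tendsto_add[OF this qx] have qy: "(\<lambda>j. y (q j)) \<longlonglongrightarrow> xs" by simp
  have \<gamma>_abs: "\<bar>\<gamma> (q j)\<bar> \<le> \<Gamma>" for j using q\<gamma>[of j] \<gamma>_ge[of "q j"] gamma by simp
  have \<gamma>_null: "(\<lambda>j. \<gamma> (q j) *\<^sub>R u j) \<longlonglongrightarrow> 0" if "u \<longlonglongrightarrow> 0" for u :: "nat \<Rightarrow> 'a"
  proof (rule Lim_null_comparison)
    show "\<forall>\<^sub>F j in sequentially. norm (\<gamma> (q j) *\<^sub>R u j) \<le> \<Gamma> * norm (u j)"
      using \<gamma>_abs by (intro always_eventually allI) (simp add: mult_right_mono)
    show "(\<lambda>j. \<Gamma> * norm (u j)) \<longlonglongrightarrow> 0" using tendsto_mult_right_zero[OF tendsto_norm_zero[OF that]] .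
  qed
  have xs_y: "(\<lambda>j. xs - y (q j)) \<longlonglongrightarrow> 0" using tendsto_diff[OF tendsto_const qy, of xs] by simp
  \<comment> \<open>Comparing the minimizer with \<open>xs\<close> in the model and dropping its
    quadratic term bounds \<open>P1\<close> from above by \<open>u j\<close>, which tends to
    \<open>P1 xs\<close>. The step size stands next to \<open>xs - y (q j)\<close> so that
    boundedness makes the product vanish.\<close>
  define u where "u j = p1 xs + (g (y (q j)) - \<xi> (q j)) \<bullet> (xs - y (q j)) + ((\<gamma> (q j) *\<^sub>R (xs - y (q j))) \<bullet> (xs - y (q j))) / 2
    - (g (y (q j)) - \<xi> (q j)) \<bullet> (x (Suc (q j)) - y (q j))" for j
  have "u \<longlonglongrightarrow> p1 xs + (g xs - \<xi>s) \<bullet> (xs - xs) + (0 \<bullet> (xs - xs)) / 2 - (g xs - \<xi>s) \<bullet> (xs - xs)"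
    unfolding u_def by (intro tendsto_intros tendsto_g qy q\<xi> qxS \<gamma>_null[OF xs_y]) simp_all
  then have u: "(\<lambda>j. ereal (u j)) \<longlonglongrightarrow> P1 xs" by (simp add: P1_eq[OF xs_dom])
  have "P1 (x (Suc (q j))) \<le> ereal (u j)" for j
  proof -
    have "0 \<le> \<gamma> (q j) / 2 * (norm (x (Suc (q j)) - y (q j)))\<^sup>2"
      using \<gamma>_ge[of "q j"] gamma by simp
    then show ?thesis
      using prox_le[OF x_prox[of "q j"] xs_dom]
      by (simp add: u_def P1_eq[OF x_dom] power2_norm_eq_inner)
  qed
  then have P1_lim: "(\<lambda>j. P1 (x (Suc (q j)))) \<longlonglongrightarrow> P1 xs"
    using lsc_tendsto[OF P1_closed qxS _ u] by blast
  have xS_y: "(\<lambda>j. x (Suc (q j)) - y (q j)) \<longlonglongrightarrow> 0" using tendsto_diff[OF qxS qy] by simp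
  have "(\<lambda>j. - (g (y (q j)) - \<xi> (q j) + \<gamma> (q j) *\<^sub>R (x (Suc (q j)) - y (q j)))) \<longlonglongrightarrow> - (g xs - \<xi>s + 0)"
    by (intro tendsto_intros tendsto_g qy q\<xi> \<gamma>_null[OF xS_y])
  then have lim: "\<xi>s - g xs \<in> limiting_subdiff P1 xs"
    unfolding limiting_subdiff_def mem_Collect_eq
    using qxS P1_lim optimality P1_eq[OF xs_dom]
    by (intro conjI exI[of _ "\<lambda>j. x (Suc (q j))"] exI[of _ "\<lambda>j. - (g (y (q j)) - \<xi> (q j) + \<gamma> (q j) *\<^sub>R (x (Suc (q j)) - y (q j)))"]) auto
  have "P2 xs + \<xi>s \<bullet> (z - xs) \<le> P2 z" for z
  proof (rule LIMSEQ_le_const2)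
    show "(\<lambda>j. P2 (x (q j)) + \<xi> (q j) \<bullet> (z - x (q j))) \<longlonglongrightarrow> P2 xs + \<xi>s \<bullet> (z - xs)"
      by (intro tendsto_intros tendsto_P2 qx q\<xi>)
  qed (use \<xi>_subgradient in blast)
  then have "\<xi>s \<in> limiting_subdiff (\<lambda>z. ereal (P2 z)) xs"
    by (simp add: limiting_subdiff_convex_iff[OF P2_convex])
  moreover have "0 = g xs + (\<xi>s - g xs) - \<xi>s" by simp
  moreover have "xs \<in> effdom (objective f P1 P2)" by (simp add: effdom_def objective_eq[OF xs_dom])
  ultimately show "stationary_point f g P1 P2 xs"
    unfolding stationary_point_def using lim by blast
  have "(\<lambda>j. p1 (x (Suc (q j)))) \<longlonglongrightarrow> p1 xs"
    using P1_lim by (simp add: P1_eq x_dom xs_dom)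
  then have "(\<lambda>j. F (x (Suc (q j)))) \<longlonglongrightarrow> F xs"
    unfolding F_def by (intro tendsto_intros tendsto_f tendsto_P2 qxS)
  \<comment> \<open>Removing the vanishing quadratic term from the potential shows that the
    objective values along the whole sequence tend to \<open>Rlim\<close>.\<close>
  moreover have "(\<lambda>k. h k - \<delta> / 8 * (\<gamma> k * (d k)\<^sup>2)) \<longlonglongrightarrow> Rlim - \<delta> / 8 * 0"
    by (intro tendsto_intros h_tendsto \<gamma>_d_tendsto)
  then have "(\<lambda>k. F (x (Suc k))) \<longlonglongrightarrow> Rlim" by (simp add: h_def)
  from sub[OF this] have "(\<lambda>j. F (x (Suc (q j)))) \<longlonglongrightarrow> Rlim" .
  ultimately show "F xs = Rlim" by (rule LIMSEQ_unique)
qed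

section \<open>Subgradients of the potential at the iterates\<close>

lemma xs_in_N: "xs \<in> N"
  using accumulation_stationary N_stationary by blast

text \<open>The subgradient that \<open>potential_frechet\<close> builds from the one in
  \<open>optimality\<close>.\<close>

definition sg :: "nat \<Rightarrow> 'a \<times> 'a \<times> real" where
  "sg k = (- (g (y k) - \<xi> k + \<gamma> k *\<^sub>R (x (Suc k) - y k)) +
      (g (x (Suc k)) - gP2 (x (Suc k)) + (\<delta> * \<gamma> k / 4) *\<^sub>R (x (Suc k) - x k)),
    - ((\<delta> * \<gamma> k / 4) *\<^sub>R (x (Suc k) - x k)), \<delta> / 8 * (norm (x (Suc k) - x k))\<^sup>2)"

lemma sg_frechet:
  "x (Suc k) \<in> N \<Longrightarrow> sg k \<in> frechet_subdiff (potential f P1 P2 \<delta>) (x (Suc k), x k, \<gamma> k)"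
  unfolding sg_def by (intro potential_frechet optimality g_gradient gP2_gradient)

lemma sg_bound:
  assumes L1: "L1-lipschitz_on (ball xs \<rho>) g" and L2: "L2-lipschitz_on (ball xs \<rho>) gP2" and N: "ball xs \<rho> \<subseteq> N"
    and ball: "x (Suc k) \<in> ball xs \<rho>" "x k \<in> ball xs \<rho>" "y k \<in> ball xs \<rho>"
    and \<Gamma>: "\<gamma> k \<le> \<Gamma>" and d1: "d k \<le> 1"
  shows "norm (sg k) \<le> ((L1 + \<Gamma>) * (1 + \<beta>max) + L2 + \<Gamma> + 1) * (d k + e k)"
proof -
  have nonneg: "0 \<le> L1" "0 \<le> L2" "0 \<le> d k" "0 \<le> e k" "0 \<le> \<gamma> k" "0 \<le> \<Gamma>"
    using L1 L2 lipschitz_on_nonneg \<gamma>_ge[of k] gamma \<Gamma> by (auto simp: d_def e_def)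
  \<comment> \<open>Inside \<open>N\<close> the chosen subgradient is the gradient, so the terms of
    \<open>P2\<close> form a difference of gradients at consecutive iterates.\<close>
  have "\<xi> k = gP2 (x k)"
    using gP2_gradient ball N by (intro subgradient_eq_gradient[OF _ \<xi>_subgradient]) auto
  then have eq: "- (g (y k) - \<xi> k + \<gamma> k *\<^sub>R (x (Suc k) - y k)) +
      (g (x (Suc k)) - gP2 (x (Suc k)) + (\<delta> * \<gamma> k / 4) *\<^sub>R (x (Suc k) - x k)) =
      (g (x (Suc k)) - g (y k)) - (gP2 (x (Suc k)) - gP2 (x k)) - \<gamma> k *\<^sub>R (x (Suc k) - y k)
      + (\<delta> * \<gamma> k / 4) *\<^sub>R (x (Suc k) - x k)" (is "?A = ?a - ?b - ?c + ?e")
    by simp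
  have "norm (x (Suc k) - y k) \<le> d k + norm (y k - x k)"
    using norm_triangle_ineq4[of "x (Suc k) - x k" "y k - x k"] by (simp add: d_def)
  then have xy: "norm (x (Suc k) - y k) \<le> d k + \<beta>max * e k" using y_close[of k] by linarith
  also have "\<dots> \<le> (1 + \<beta>max) * (d k + e k)"
    using nonneg beta by (simp add: algebra_simps)
  finally have xy: "norm (x (Suc k) - y k) \<le> (1 + \<beta>max) * (d k + e k)" .
  have a: "norm ?a \<le> L1 * ((1 + \<beta>max) * (d k + e k))"
    using lipschitz_onD[OF L1 ball(1,3)] mult_left_mono[OF xy nonneg(1)] by (simp add: dist_norm)
  have b: "norm ?b \<le> L2 * (d k + e k)"
    using lipschitz_onD[OF L2 ball(1,2)] mult_left_mono[of "d k" "d k + e k", OF _ nonneg(2)] nonneg(4)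
    by (simp add: dist_norm d_def)
  have c: "norm ?c \<le> \<Gamma> * ((1 + \<beta>max) * (d k + e k))"
    using mult_mono[OF \<Gamma> xy] nonneg by simp
  have "\<delta> * \<gamma> k \<le> 1 * \<Gamma>" using \<Gamma> delta nonneg by (intro mult_mono) auto
  then have "\<delta> * \<gamma> k / 4 * d k \<le> \<Gamma> / 4 * (d k + e k)"
    using nonneg delta by (intro mult_mono) auto
  then have ee: "norm ?e \<le> \<Gamma> / 4 * (d k + e k)"
    using nonneg delta by (simp add: d_def)
  \<comment> \<open>\<open>d k \<le> 1\<close> turns the square in the step-size component into a
    linear bound.\<close>
  have "\<delta> * (d k)\<^sup>2 \<le> 1 * (1 * (d k + e k))"
    using delta nonneg d1 unfolding power2_eq_square by (intro mult_mono) auto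
  then have s: "norm (\<delta> / 8 * (norm (x (Suc k) - x k))\<^sup>2) \<le> d k + e k"
    using delta nonneg unfolding d_def[symmetric] by simp
  have "norm ?A \<le> norm ?a + norm ?b + norm ?c + norm ?e"
    unfolding eq using norm_triangle_ineq[of "?a - ?b - ?c" ?e] norm_triangle_ineq4[of "?a - ?b" ?c]
      norm_triangle_ineq4[of ?a ?b] by linarith
  moreover have "norm (sg k) \<le> norm ?A + (norm ?e + norm (\<delta> / 8 * (norm (x (Suc k) - x k))\<^sup>2))"
    using norm_Pair_le[of ?A "(- ?e, \<delta> / 8 * (norm (x (Suc k) - x k))\<^sup>2)"]
      norm_Pair_le[of "- ?e" "\<delta> / 8 * (norm (x (Suc k) - x k))\<^sup>2"]
    unfolding sg_def norm_minus_cancel by linarith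
  ultimately have "norm (sg k) \<le> L1 * ((1 + \<beta>max) * (d k + e k)) + L2 * (d k + e k) + \<Gamma> * ((1 + \<beta>max) * (d k + e k))
      + \<Gamma> / 2 * (d k + e k) + (d k + e k)"
    using a b c ee s by linarith
  moreover have "\<Gamma> / 2 * (d k + e k) \<le> \<Gamma> * (d k + e k)"
    using nonneg by (intro mult_right_mono) auto
  moreover have "((L1 + \<Gamma>) * (1 + \<beta>max) + L2 + \<Gamma> + 1) * (d k + e k) =
      L1 * ((1 + \<beta>max) * (d k + e k)) + \<Gamma> * ((1 + \<beta>max) * (d k + e k)) + L2 * (d k + e k) + \<Gamma> * (d k + e k) + (d k + e k)"
    by (simp only: distrib_right[of _ _ "d k + e k"] distrib_right[of _ _ "1 + \<beta>max"] mult.assoc mult_1_left)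
  ultimately show ?thesis by linarith
qed

section \<open>Convergence of the whole sequence\<close>

lemma convergence:
  assumes KL: "KL_function_on {(u, v, \<gamma>). 0 < \<gamma>} (potential f P1 P2 \<delta>)"
  shows "x \<longlonglongrightarrow> xs"
proof -
  obtain \<rho>1 \<Gamma> where \<Gamma>: "\<rho>1 > 0" "\<forall>\<^sub>F k in sequentially. dist (x k) xs < \<rho>1 \<longrightarrow> \<gamma> k \<le> \<Gamma>"
    using stepsize_bounded_near by metis
  \<comment> \<open>The maximum keeps the step-size interval \<open>{\<gamma>min..\<Gamma>'}\<close>
    nonempty.\<close>
  define \<Gamma>' where "\<Gamma>' = max \<Gamma> \<gamma>min"
  have \<Gamma>': "\<gamma>min \<le> \<Gamma>'" "\<Gamma> \<le> \<Gamma>'" by (auto simp: \<Gamma>'_def)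
  have "KL_at (potential f P1 P2 \<delta>) (xs, xs, t)" if "\<gamma>min \<le> t" for t
    using KL that gamma stationary_in_dom_subdiff_potential[OF accumulation_stationary N_open xs_in_N f_C1 P2_C1]
    unfolding KL_function_on_def by auto
  moreover have "potential f P1 P2 \<delta> (xs, xs, t) = ereal Rlim" for t
    \<comment> \<open>On the diagonal the quadratic term is 0, so the value is the same for all step
      sizes, as \<open>KL_uniformized\<close> requires.\<close>
    by (simp add: potential_real xs_dom accumulation_value)
  ultimately obtain \<rho>2 \<nu> \<phi> \<psi> where KL': "\<rho>2 > 0" "\<nu> > 0" "desing_pair \<nu> \<phi> \<psi>"
    "uniform_KL (potential f P1 P2 \<delta>) xs Rlim \<gamma>min \<Gamma>' \<rho>2 \<nu> \<psi>"
    using KL_uniformized[OF \<Gamma>'(1)] by metis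
  obtain \<rho>3 L1 where L1: "\<rho>3 > 0" "L1-lipschitz_on (ball xs \<rho>3) g"
    using f_lip unfolding locally_lipschitz_on_def Int_UNIV_right by blast
  obtain \<rho>4 L2 where L2: "\<rho>4 > 0" "L2-lipschitz_on (ball xs \<rho>4 \<inter> N) gP2"
    using P2_lip xs_in_N unfolding locally_lipschitz_on_def by blast
  obtain \<rho>5 where \<rho>5: "\<rho>5 > 0" "ball xs \<rho>5 \<subseteq> N" using N_open xs_in_N open_contains_ball by blast
  define \<rho> where "\<rho> = min \<rho>1 (min \<rho>2 (min \<rho>3 (min \<rho>4 \<rho>5)))"
  have \<rho>: "\<rho> > 0" "\<rho> \<le> \<rho>1" "\<rho> \<le> \<rho>2" "\<rho> \<le> \<rho>3" "\<rho> \<le> \<rho>4" "\<rho> \<le> \<rho>5"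
    using \<Gamma> KL' L1 L2 \<rho>5 by (auto simp: \<rho>_def)
  have N: "ball xs \<rho> \<subseteq> N" using \<rho>5 \<rho>(6) subset_ball by blast
  have lip: "L1-lipschitz_on (ball xs \<rho>) g" "L2-lipschitz_on (ball xs \<rho>) gP2"
    using N \<rho> by (auto intro: lipschitz_on_subset[OF L1(2)] lipschitz_on_subset[OF L2(2)])
  define C where "C = (L1 + \<Gamma>') * (1 + \<beta>max) + L2 + \<Gamma>' + 1"
  have "0 < C"
    using lip[THEN lipschitz_on_nonneg] \<Gamma>' gamma beta unfolding C_def by (intro add_pos_pos add_nonneg_pos mult_nonneg_nonneg) auto
  define \<Theta> where "\<Theta> t = sqrt t / ((1 - sqrt (1 - pmin / 2)) * sqrt \<kappa>) + 2 * C / \<kappa> * \<phi> (t / 2)" for t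
  define \<theta> where "\<theta> k = \<Theta> (R' k - Rlim)" for k
  have r0: "(\<lambda>k. R' k - Rlim) \<longlonglongrightarrow> 0" using tendsto_diff[OF R'_tendsto tendsto_const, of Rlim] by simp
  have \<theta>_lim: "\<theta> \<longlonglongrightarrow> 0"
  proof -
    have "(\<lambda>k. (R' k - Rlim) / 2) \<longlonglongrightarrow> 0" using tendsto_divide_zero[OF r0] .
    from desing_pair_tendsto[OF KL'(3) this] have "(\<lambda>k. \<phi> ((R' k - Rlim) / 2)) \<longlonglongrightarrow> 0"
      using Rlim_le by simp
    moreover have "(\<lambda>k. sqrt (R' k - Rlim)) \<longlonglongrightarrow> 0" using tendsto_real_sqrt[OF r0] by simp
    ultimately have "\<theta> \<longlonglongrightarrow> 0 / ((1 - sqrt (1 - pmin / 2)) * sqrt \<kappa>) + 2 * C / \<kappa> * 0"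
      unfolding \<theta>_def \<Theta>_def divide_inverse by (intro tendsto_intros)
    then show ?thesis by simp
  qed
  have ev_\<nu>: "\<forall>\<^sub>F k in sequentially. R' k - Rlim < \<nu>" using r0 KL'(2) by (rule order_tendstoD)
  \<comment> \<open>The potential value \<open>h (k + 1)\<close> belongs to the point
    \<open>x (k + 2)\<close> and has a subgradient bounded by \<open>d (k + 1) + d k\<close>. It
    controls the next step, \<open>d (k + 2)\<close>, hence the shift by 2 and the reference values
    from \<open>k + 1\<close> to \<open>k + 3\<close>.\<close>
  have step: "\<forall>\<^sub>F k in sequentially. dist (x (k + 2)) xs < \<rho> / 2 \<longrightarrow>
      d (k + 2) \<le> (d (k + 1) + d k) / 4 + (\<theta> (k + 1) - \<theta> (k + 3))"
  proof -
    have "(\<lambda>k. \<beta>max * d k) \<longlonglongrightarrow> 0" using tendsto_mult_right_zero[OF d_tendsto] .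
    then have "\<forall>\<^sub>F k in sequentially. \<beta>max * d k < \<rho> / 4" using \<rho>(1) by (intro order_tendstoD(2)) auto
    moreover have "\<forall>\<^sub>F k in sequentially. d (Suc k) < min 1 (\<rho> / 4)"
      using LIMSEQ_Suc[OF d_tendsto] \<rho>(1) by (intro order_tendstoD(2)) auto
    moreover have "\<forall>\<^sub>F k in sequentially. dist (x (Suc k)) xs < \<rho>1 \<longrightarrow> \<gamma> (Suc k) \<le> \<Gamma>"
      using \<Gamma>(2) by (subst eventually_sequentially_Suc)
    moreover have "\<forall>\<^sub>F k in sequentially. R' (Suc k) - Rlim < \<nu>"
      using ev_\<nu> by (subst eventually_sequentially_Suc)
    ultimately show ?thesis
    proof eventually_elim
      case (elim k)
      show ?case
      proof
        assume near: "dist (x (k + 2)) xs < \<rho> / 2"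
        have x2: "x (Suc (Suc k)) \<in> ball xs \<rho>" using near \<rho>(1) by (simp add: dist_commute)
        \<comment> \<open>Only \<open>x (k + 2)\<close> is assumed near; since steps and
          extrapolations tend to 0, the preceding iterate and its extrapolated point are near as
          well.\<close>
        have d1: "dist (x (Suc k)) xs < 3 * \<rho> / 4"
          using near elim(2) dist_triangle[of "x (Suc k)" xs "x (Suc (Suc k))"]
          by (simp add: d_def dist_norm norm_minus_commute)
        then have x1: "x (Suc k) \<in> ball xs \<rho>" using \<rho>(1) by (simp add: dist_commute)
        have "norm (y (Suc k) - x (Suc k)) < \<rho> / 4"
          using y_close[of "Suc k"] elim(1) by (simp add: e_Suc)
        then have y1: "y (Suc k) \<in> ball xs \<rho>"
          using d1 dist_triangle[of xs "y (Suc k)" "x (Suc k)"] by (simp add: dist_norm norm_minus_commute)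
        have \<gamma>: "\<gamma> (Suc k) \<le> \<Gamma>'" using elim(3) x1 \<rho>(2) \<Gamma>'(2) by (auto simp: dist_commute)
        have bound: "norm (sg (Suc k)) \<le> C * (d (k + 1) + d k)"
          using sg_bound[OF lip N x2 x1 y1 \<gamma>] elim(2) by (simp add: C_def e_Suc)
        have KLs: "1 \<le> \<psi> (h (k + 1) - Rlim) * (C * (d (k + 1) + d k))" if pos: "0 < h (k + 1) - Rlim"
        proof -
          have lt: "h (k + 1) - Rlim < \<nu>" using h_le[of "Suc k"] elim(4) by simp
          have "1 \<le> \<psi> (h (Suc k) - Rlim) * norm (sg (Suc k))"
          proof (rule uniform_KLD[OF KL'(4) _ _ _ h_eq])
            show "sg (Suc k) \<in> frechet_subdiff (potential f P1 P2 \<delta>) (x (Suc (Suc k)), x (Suc k), \<gamma> (Suc k))"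
              using x2 N by (intro sg_frechet) auto
          qed (use x1 x2 \<rho>(3) \<gamma> \<gamma>_ge[of "Suc k"] pos lt in \<open>auto simp: dist_commute\<close>)
          also have "\<dots> \<le> \<psi> (h (Suc k) - Rlim) * (C * (d (k + 1) + d k))"
            using bound KL'(3) pos lt by (intro mult_left_mono) (auto simp: desing_pair_def less_imp_le)
          finally show ?thesis by simp
        qed
        have "d (k + 2) \<le> (d (k + 1) + d k) / 4 + (\<Theta> (R' (k + 1) - Rlim) - \<Theta> (R' (k + 3) - Rlim))"
        proof (rule line_search_combination[where \<Theta> = \<Theta> and b = "R' (k + 2) - Rlim" and s = "h (k + 1) - Rlim",
              OF KL'(3) \<kappa>_pos \<open>0 < C\<close> pmin])
          show "\<kappa> * (d (k + 2))\<^sup>2 \<le> R' (k + 2) - Rlim - (R' (k + 3) - Rlim)"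
            using R'_square_decrease[of "k + 2"] by (simp add: numeral_3_eq_3)
          show "pmin * (R' (k + 1) - Rlim - (h (k + 1) - Rlim)) \<le> R' (k + 1) - Rlim - (R' (k + 2) - Rlim)"
            using R'_drop[of "k + 1"] by simp
          show "h (k + 1) - Rlim \<le> R' (k + 2) - Rlim" using h_le_Suc[of "k + 1"] by simp
          show "R' (k + 3) - Rlim \<le> R' (k + 2) - Rlim" "R' (k + 2) - Rlim \<le> R' (k + 1) - Rlim"
            using decseqD[OF R'_decseq, of "k + 2" "k + 3"] decseqD[OF R'_decseq, of "k + 1" "k + 2"] by simp_all
          show "R' (k + 1) - Rlim < \<nu>" using elim(4) by simp
          show "0 \<le> R' (k + 3) - Rlim" using Rlim_le by simp
          show "0 \<le> d (k + 2)" "0 \<le> d (k + 1) + d k" by (simp_all add: d_def)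
        qed (rule KLs \<Theta>_def, assumption?)+
        then show "d (k + 2) \<le> (d (k + 1) + d k) / 4 + (\<theta> (k + 1) - \<theta> (k + 3))"
          by (simp add: \<theta>_def)
      qed
    qed
  qed
  have \<theta>_nonneg: "\<forall>\<^sub>F k in sequentially. 0 \<le> \<theta> k"
    using ev_\<nu>
  proof eventually_elim
    case (elim k)
    have "\<phi> 0 \<le> \<phi> ((R' k - Rlim) / 2)"
      using elim Rlim_le[of k] KL'(2) by (intro desing_pair_mono_fun[OF KL'(3)]) auto
    then have "0 \<le> \<phi> ((R' k - Rlim) / 2)" using KL'(3) by (simp add: desing_pair_def)
    moreover have "0 < 1 - sqrt (1 - pmin / 2)" using pmin by simp
    ultimately show ?case
      unfolding \<theta>_def \<Theta>_def using \<open>0 < C\<close> \<kappa>_pos Rlim_le[of k]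
      by (intro add_nonneg_nonneg divide_nonneg_nonneg mult_nonneg_nonneg) auto
  qed
  \<comment> \<open>Twice the estimate \<open>step\<close>, with one \<open>d (k + 2)\<close> moved
    to the right, is exactly \<open>d (k + 2) \<le> W k - W (Suc k)\<close>; the terms in
    \<open>d\<close> make the two preceding steps telescope.\<close>
  define W where "W k = 2 * (\<theta> (k + 1) + \<theta> (k + 2)) + d (k + 1) + d k / 2" for k
  show ?thesis
  \<comment> \<open>Undoes the shift by 2. Truncated subtraction affects only \<open>k < 2\<close>,
    and all conditions are eventual.\<close>
  proof (rule finite_length_convergence[where W = "\<lambda>k. W (k - 2)", OF _ _ _ _ r])
    show "\<rho> / 2 > 0" using \<rho>(1) by simp
    have "\<forall>\<^sub>F k in sequentially. 0 \<le> \<theta> (k + 1)" "\<forall>\<^sub>F k in sequentially. 0 \<le> \<theta> (k + 2)"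
      using \<theta>_nonneg eventually_sequentially_seg[of "\<lambda>k. 0 \<le> \<theta> k" 1]
        eventually_sequentially_seg[of "\<lambda>k. 0 \<le> \<theta> k" 2] by blast+
    then have "\<forall>\<^sub>F k in sequentially. 0 \<le> W k"
      by eventually_elim (simp add: W_def d_def)
    then show "\<forall>\<^sub>F k in sequentially. 0 \<le> W (k - 2)"
      by (subst eventually_sequentially_seg[of _ 2, symmetric]) simp
    note shift = LIMSEQ_ignore_initial_segment
    have "(\<lambda>k. 2 * (\<theta> (k + 1) + \<theta> (k + 2))) \<longlonglongrightarrow> 0"
      by (rule tendsto_mult_right_zero[OF tendsto_add_zero[OF shift[OF \<theta>_lim] shift[OF \<theta>_lim]]])
    from tendsto_add_zero[OF tendsto_add_zero[OF this shift[OF d_tendsto, of 1]] tendsto_divide_zero[OF d_tendsto, of 2]]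
    have "W \<longlonglongrightarrow> 0" unfolding W_def [abs_def] .
    then show "(\<lambda>k. W (k - 2)) \<longlonglongrightarrow> 0" by (intro LIMSEQ_offset[of "\<lambda>k. W (k - 2)" 2 0]) simp
    have "\<forall>\<^sub>F k in sequentially. dist (x (k + 2)) xs < \<rho> / 2 \<longrightarrow> dist (x (Suc (k + 2))) (x (k + 2)) \<le> W k - W (Suc k)"
      using step
    proof eventually_elim
      case (elim k)
      have "W k - W (Suc k) = 2 * (\<theta> (k + 1) - \<theta> (k + 3)) + (d (k + 1) + d k) / 2 - d (k + 2)"
        by (simp add: W_def numeral_2_eq_2 numeral_3_eq_3 add_divide_distrib)
      moreover have "dist (x (Suc (k + 2))) (x (k + 2)) = d (k + 2)" by (simp only: d_def dist_norm)
      ultimately have "dist (x (Suc (k + 2))) (x (k + 2)) \<le> W k - W (Suc k)"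
        if "d (k + 2) \<le> (d (k + 1) + d k) / 4 + (\<theta> (k + 1) - \<theta> (k + 3))"
        using that by argo
      with elim show ?case by blast
    qed
    then show "\<forall>\<^sub>F k in sequentially. dist (x k) xs < \<rho> / 2 \<longrightarrow> dist (x (Suc k)) (x k) \<le> W (k - 2) - W (Suc k - 2)"
      by (subst eventually_sequentially_seg[of _ 2, symmetric]) simp
  qed
qed

end

theorem theorem4p1:
  fixes f P2 :: "real ^ 'n \<Rightarrow> real"
    and P1 :: "real ^ 'n \<Rightarrow> ereal"
    and gradf gradP2 :: "real ^ 'n \<Rightarrow> real ^ 'n"
    and N :: "(real ^ 'n) set"
    and \<gamma>min \<gamma>max \<beta>max pmin \<delta> \<tau> \<eta> :: real
    and x :: "nat \<Rightarrow> real ^ 'n"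
    and xstar :: "real ^ 'n"
  assumes f_C1: "C1_with_gradient_on UNIV f gradf"
    and f_lip: "locally_lipschitz_on UNIV gradf"
    and P1_proper: "proper_fun P1"
    and P1_closed: "lsc P1"
    and P1_prox_bounded: "prox_bounded P1"
    and P2_convex: "convex_on UNIV P2"
    and F_bounded_below: "\<exists>m::real. \<forall>z \<in> effdom P1. ereal m \<le> objective f P1 P2 z"
    and N_open: "open N"
    and N_stationary: "{z. stationary_point f gradf P1 P2 z} \<subseteq> N"
    and P2_C1: "C1_with_gradient_on N P2 gradP2"
    and P2_lip: "locally_lipschitz_on N gradP2"
    and gamma: "0 < \<gamma>min" "\<gamma>min \<le> \<gamma>max"
    and beta: "0 \<le> \<beta>max"
    and pmin: "0 < pmin" "pmin < 1"
    and delta: "0 \<le> \<delta>" "\<delta> < 1"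
    and tau: "1 < \<tau>"
    and eta: "0 < \<eta>" "\<eta> < 1 / sqrt \<tau>"
    and generated: "nexPGA_sequence f gradf P1 P2 \<gamma>min \<gamma>max \<beta>max pmin \<delta> \<tau> \<eta> x"
    and accumulation: "\<exists>r. strict_mono r \<and> (x \<circ> r) \<longlonglongrightarrow> xstar"
    and KL: "KL_function_on {(u, v, \<gamma>). 0 < \<gamma>} (potential f P1 P2 \<delta>)"
  shows "x \<longlonglongrightarrow> xstar \<and> stationary_point f gradf P1 P2 xstar"
proof -
  obtain \<xi> \<beta>0 \<gamma>0 trial acc p R where
    run: "nexPGA_run f gradf P1 P2 \<gamma>min \<gamma>max \<beta>max pmin \<delta> \<tau> \<eta> x \<xi> \<beta>0 \<gamma>0 trial acc p R"
    using generated unfolding nexPGA_sequence_def by blast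
  obtain r where r: "strict_mono r" "(x \<circ> r) \<longlonglongrightarrow> xstar" using accumulation by blast
  interpret nexPGA f P2 P1 gradf gradP2 N \<gamma>min \<gamma>max \<beta>max pmin \<delta> \<tau> \<eta> x \<xi> \<beta>0 \<gamma>0 trial acc p R xstar r
    by (rule nexPGA.intro; fact)
  show ?thesis using convergence[OF KL] accumulation_stationary by blast
qed

end
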